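(* Let $r\in\mathbb{N}$, $k\in\mathbb{Z}_+$ with $k\leqslant r-1$, and $t\in(-1,1)$. For $N\geqslant M_t$, let $\lambda_{N,t}\geqslant 0$ be such that $N=\left\|u_{\lambda_{N,t},t}^{(r)}\right\|_2$, and consider the functional $S_{N,t}:L_2\to\mathbb{R}$, \[ S_{N,t}f=\int_{-1}^1u^{(r)}_{\lambda_{N,t},t}(x)f(x)\,dx,\qquad f\in L_2 . \] Then, for $N\in(0,M_t)$, $E_N\left(D^k_t;W^r_2\right)=+\infty$, and, for $N\geqslant M_t$, \[ E_N\left(D^k_t;W^r_2\right)=U\left(D^k_t;S_{N,t};W^r_2\right)=\left\|u_{\lambda_{N,t},t}\right\|_2 . \]
   Context: Let $\mathbb{I}=[-1,1]$, $L_2=L_2(\mathbb{I})$ (real-valued functions) with norm $\|f\|_2=\left(\int_{-1}^1|f(x)|^2\,dx\right)^{1/2}$. For $m\in\mathbb{N}$, $L_2^m$ is the space of functions $f:\mathbb{I}\to\mathbb{R}$ having absolutely continuous derivative $f^{(m-1)}$ and such that $f^{(m)}\in L_2$; $L_2^m((a,b))$ is the analogous space on an interval $(a,b)$. Let $W^r_2=\{f\in L_2^r:\|f^{(r)}\|_2\leqslant 1\}$. For $\lambda\geqslant 0$ and $t\in(-1,1)$ (with $r,k$ fixed), $u_{\lambda,t}$ denotes the unique function whose restrictions to $(-1,t)$ and $(t,1)$ belong to $L_2^{2r}((-1,t))$ and $L_2^{2r}((t,1))$ respectively and which satisfies \[ \begin{cases}(-1)^ru^{(2r)}(x)+\lambda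 u(x)=0,& x\in(-1,t)\cup(t,1),\\ u^{(s)}(-1)=u^{(s)}(1)=0,& s=0,1,\ldots,r-1,\\ u^{(s)}(t+0)-u^{(s)}(t-0)=(-1)^{k-1}\delta_{r-k-1,s},& s=0,1,\ldots,2r-1,\end{cases} \] where $\delta_{i,j}$ is the Kronecker symbol. The derivatives $u_{\lambda,t}^{(s)}$ are taken on $(-1,t)\cup(t,1)$; for $0\leqslant s\leqslant 2r-1$, $s\ne r-k-1$, they are extended to $\mathbb{I}$ by continuity. $M_t$ is the sharp (smallest possible) constant in the inequality $|Q^{(k)}(t)|\leqslant M_t\|Q\|_2$ for all $Q\in\mathcal{P}_{r-1}$, where $\mathcal{P}_{r-1}$ is the set of real algebraic polynomials of degree at most $r-1$. $D^k_t$ is the functional $f\mapsto f^{(k)}(t)$ with domain $L_2^r$. For a linear functional $S:L_2\to\mathbb{R}$, \[ U(D^k_t;S;W^r_2)=\sup_{f\in W^r_2}|f^{(k)}(t)-Sf|, \] and $E_N(D^k_t;W^r_2)=\inf U(D^k_t;S;W^r_2)$, the infimum being over all bounded linear functionals $S:L_2\to\mathbb{R}$ with norm $\|S\|\leqslant N$. *)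

theory Defs
  imports "HOL-Analysis.Analysis" "HOL-Computational_Algebra.Polynomial"
begin

text \<open>Elements of \<open>L\<^sub>2(S)\<close> are represented by functions on the whole line; only their
  values almost everywhere on \<open>S\<close> matter.\<close>

definition L2_on :: "real set \<Rightarrow> (real \<Rightarrow> real) set" where
  "L2_on S = {f. f \<in> borel_measurable (lebesgue_on S) \<and> integrable (lebesgue_on S) (\<lambda>x. (f x)\<^sup>2)}"

abbreviation L2 :: "(real \<Rightarrow> real) set" where
  "L2 \<equiv> L2_on {-1..1}"

definition L2_norm :: "(real \<Rightarrow> real) \<Rightarrow> real" where
  "L2_norm f = sqrt (LINT x|lebesgue_on {-1..1}. \<bar>f x\<bar>\<^sup>2)"

text \<open>The derivative of order \<open>j\<close> relative to \<open>S\<close>: one-sided at end points of a closed interval,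
  ordinary at points of an open set. It is unspecified where a derivative does not exist.\<close>

definition nderiv_on :: "real set \<Rightarrow> nat \<Rightarrow> (real \<Rightarrow> real) \<Rightarrow> real \<Rightarrow> real" where
  "nderiv_on S j f = ((\<lambda>g x. vector_derivative g (at x within S)) ^^ j) f"

definition abs_continuous_on :: "real set \<Rightarrow> (real \<Rightarrow> real) \<Rightarrow> bool" where
  "abs_continuous_on S f \<longleftrightarrow>
     (\<forall>e>0. \<exists>d>0. \<forall>P. finite P \<and> (\<forall>(a, b)\<in>P. a < b \<and> {a..b} \<subseteq> S) \<and>
        disjoint_family_on (\<lambda>(a, b). {a<..<b}) P \<and> (\<Sum>(a, b)\<in>P. b - a) < d
        \<longrightarrow> (\<Sum>(a, b)\<in>P. \<bar>f b - f a\<bar>) < e)"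

text \<open>The space \<open>L\<^sub>2\<^sup>m(S)\<close> for an interval \<open>S\<close> and \<open>m \<ge> 1\<close>. The almost everywhere clause is
  automatic for an absolutely continuous function; it makes explicit that \<open>f\<^sup>(\<^sup>m\<^sup>)\<close> in the last
  clause is a genuine derivative.\<close>

definition L2_diff :: "nat \<Rightarrow> real set \<Rightarrow> (real \<Rightarrow> real) set" where
  "L2_diff m S = {f.
     (\<forall>j<m - 1. \<forall>x\<in>S. nderiv_on S j f differentiable (at x within S)) \<and>
     abs_continuous_on S (nderiv_on S (m - 1) f) \<and>
     (AE x in lebesgue_on S. nderiv_on S (m - 1) f differentiable (at x within S)) \<and>
     nderiv_on S m f \<in> L2_on S}"

definition W2 :: "nat \<Rightarrow> (real \<Rightarrow> real) set" where
  "W2 r = {f \<in> L2_diff r {-1..1}. L2_norm (nderiv_on {-1..1} r f) \<le> 1}"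

text \<open>Derivatives of a function on \<open>(-1,t) \<union> (t,1)\<close>. Their values at the three points
  \<open>-1\<close>, \<open>t\<close>, \<open>1\<close> are irrelevant: below they enter only through one-sided limits and integrals.\<close>

abbreviation pderivs :: "real \<Rightarrow> nat \<Rightarrow> (real \<Rightarrow> real) \<Rightarrow> real \<Rightarrow> real" where
  "pderivs t s u \<equiv> nderiv_on ({-1<..<t} \<union> {t<..<1}) s u"

text \<open>\<open>is_u r k lam t u\<close>: the function \<open>u\<close> is the solution \<open>u\<^bsub>lam,t\<^esub>\<close> of the boundary value
  problem (it is determined by it on \<open>(-1,t) \<union> (t,1)\<close>).
  The integer power covers the sign \<open>(-1)\<close> to the \<open>k - 1\<close> at \<open>k = 0\<close>.\<close>

definition is_u :: "nat \<Rightarrow> nat \<Rightarrow> real \<Rightarrow> real \<Rightarrow> (real \<Rightarrow> real) \<Rightarrow> bool" where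
  "is_u r k lam t u \<longleftrightarrow>
     u \<in> L2_diff (2 * r) {-1<..<t} \<and> u \<in> L2_diff (2 * r) {t<..<1} \<and>
     (\<forall>x \<in> {-1<..<t} \<union> {t<..<1}. (-1) ^ r * pderivs t (2 * r) u x + lam * u x = 0) \<and>
     (\<forall>s<r. (pderivs t s u \<longlongrightarrow> 0) (at_right (-1)) \<and> (pderivs t s u \<longlongrightarrow> 0) (at_left 1)) \<and>
     (\<forall>s<2 * r. \<exists>p q. (pderivs t s u \<longlongrightarrow> p) (at_right t) \<and> (pderivs t s u \<longlongrightarrow> q) (at_left t) \<and>
        p - q = (-1) powi (int k - 1) * (if int s = int r - int k - 1 then 1 else 0))"

text \<open>The admissible constants form a closed set, so the infimum \<open>M\<^sub>t\<close> is the smallest one.\<close>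

definition sharp_const :: "nat \<Rightarrow> nat \<Rightarrow> real \<Rightarrow> real" where
  "sharp_const r k t =
     Inf {M. \<forall>Q :: real poly. degree Q \<le> r - 1 \<longrightarrow>
               \<bar>poly ((pderiv ^^ k) Q) t\<bar> \<le> M * L2_norm (poly Q)}"

text \<open>Bounded linear functionals on \<open>L\<^sub>2\<close>; boundedness forces independence of the representative.\<close>

definition bounded_functional :: "((real \<Rightarrow> real) \<Rightarrow> real) \<Rightarrow> bool" where
  "bounded_functional S \<longleftrightarrow>
     (\<forall>f\<in>L2. \<forall>g\<in>L2. S (\<lambda>x. f x + g x) = S f + S g) \<and>
     (\<forall>c. \<forall>f\<in>L2. S (\<lambda>x. c * f x) = c * S f) \<and>
     (\<exists>C. \<forall>f\<in>L2. \<bar>S f\<bar> \<le> C * L2_norm f)"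

definition functional_norm :: "((real \<Rightarrow> real) \<Rightarrow> real) \<Rightarrow> real" where
  "functional_norm S = (SUP f\<in>{f \<in> L2. L2_norm f \<le> 1}. \<bar>S f\<bar>)"

definition U_err :: "nat \<Rightarrow> nat \<Rightarrow> real \<Rightarrow> ((real \<Rightarrow> real) \<Rightarrow> real) \<Rightarrow> ereal" where
  "U_err r k t S = (SUP f\<in>W2 r. ereal \<bar>nderiv_on {-1..1} k f t - S f\<bar>)"

definition E_err :: "nat \<Rightarrow> nat \<Rightarrow> real \<Rightarrow> real \<Rightarrow> ereal" where
  "E_err r k t N = (INF S\<in>{S. bounded_functional S \<and> functional_norm S \<le> N}. U_err r k t S)"

definition S_opt :: "nat \<Rightarrow> real \<Rightarrow> (real \<Rightarrow> real) \<Rightarrow> (real \<Rightarrow> real) \<Rightarrow> real" where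
  "S_opt r t u f = (LINT x|lebesgue_on {-1..1}. pderivs t r u x * f x)"

end

theory Submission
  imports Defs
begin

text \<open>
  Integrating by parts \<open>r\<close> times on both sides of \<open>t\<close>, the boundary conditions and the jump of
  \<open>u\<close> give, for every \<open>f\<close> in \<open>L\<^sub>2\<^sup>r\<close>, the identity
  \<open>f\<^sup>(\<^sup>k\<^sup>)(t) - S f = -(-1)\<^sup>r \<integral> u f\<^sup>(\<^sup>r\<^sup>)\<close>, where \<open>S\<close> is integration against \<open>u\<^sup>(\<^sup>r\<^sup>)\<close>. By
  Cauchy-Schwarz the error of \<open>S\<close> is the norm of \<open>u\<close>, attained when \<open>f\<^sup>(\<^sup>r\<^sup>)\<close> is a multiple of \<open>u\<close>.

  For the optimality take \<open>f = u\<^sup>(\<^sup>r\<^sup>)\<close>, for which \<open>f\<^sup>(\<^sup>r\<^sup>) = -(-1)\<^sup>r \<lambda> u\<close> and, by the identity,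
  \<open>f\<^sup>(\<^sup>k\<^sup>)(t) = N\<^sup>2 + \<lambda> \<parallel>u\<parallel>\<^sup>2\<close>, whereas a functional of norm at most \<open>N\<close> takes a value at most
  \<open>N\<^sup>2\<close> at \<open>f\<close>. If \<open>\<lambda> > 0\<close>, rescaling \<open>f\<close> gives the lower bound \<open>\<parallel>u\<parallel>\<close>. If \<open>\<lambda> = 0\<close>, the multiples
  of \<open>f\<close> make the error infinite unless the functional takes the value \<open>N\<^sup>2\<close> at \<open>f\<close>, and the
  equality case of Cauchy-Schwarz then forces it to be \<open>S\<close>. If \<open>N < M\<^sub>t\<close>, a functional of norm at
  most \<open>N\<close> is not exact on all polynomials of degree less than \<open>r\<close>, and again the error is infinite.
\<close>

section \<open>Absolutely continuous functions\<close>

lemma abs_continuous_onD: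
  assumes "abs_continuous_on S f" "e > 0"
  obtains d where "d > 0"
    and "\<And>P. \<lbrakk>finite P; \<And>a b. (a, b) \<in> P \<Longrightarrow> a < b \<and> {a..b} \<subseteq> S;
           disjoint_family_on (\<lambda>(a, b). {a<..<b}) P; (\<Sum>(a, b)\<in>P. b - a) < d\<rbrakk>
           \<Longrightarrow> (\<Sum>(a, b)\<in>P. \<bar>f b - f a\<bar>) < e"
proof -
  obtain d where d: "d > 0" and *: "\<forall>P. finite P \<and> (\<forall>(a, b)\<in>P. a < b \<and> {a..b} \<subseteq> S) \<and>
        disjoint_family_on (\<lambda>(a, b). {a<..<b}) P \<and> (\<Sum>(a, b)\<in>P. b - a) < d
        \<longrightarrow> (\<Sum>(a, b)\<in>P. \<bar>f b - f a\<bar>) < e"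
    using assms unfolding abs_continuous_on_def by blast
  show thesis
    by (rule that[OF d], rule *[rule_format]) auto
qed

lemma abs_continuous_on_subset:
  assumes "abs_continuous_on S f" "T \<subseteq> S"
  shows "abs_continuous_on T f"
  unfolding abs_continuous_on_def
proof (intro allI impI)
  fix e :: real assume "e > 0"
  then obtain d where d: "d > 0" and *: "\<And>P. \<lbrakk>finite P; \<And>a b. (a, b) \<in> P \<Longrightarrow> a < b \<and> {a..b} \<subseteq> S;
           disjoint_family_on (\<lambda>(a, b). {a<..<b}) P; (\<Sum>(a, b)\<in>P. b - a) < d\<rbrakk>
           \<Longrightarrow> (\<Sum>(a, b)\<in>P. \<bar>f b - f a\<bar>) < e"
    using abs_continuous_onD[OF assms(1)] by metis
  show "\<exists>d>0. \<forall>P. finite P \<and> (\<forall>(a, b)\<in>P. a < b \<and> {a..b} \<subseteq> T) \<and>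
        disjoint_family_on (\<lambda>(a, b). {a<..<b}) P \<and> (\<Sum>(a, b)\<in>P. b - a) < d
        \<longrightarrow> (\<Sum>(a, b)\<in>P. \<bar>f b - f a\<bar>) < e"
    using d assms(2) by (intro exI[of _ d] conjI allI impI *) blast+
qed

lemma abs_continuous_on_cong:
  assumes "abs_continuous_on S f" "\<And>x. x \<in> S \<Longrightarrow> g x = f x"
  shows "abs_continuous_on S g"
  unfolding abs_continuous_on_def
proof (intro allI impI)
  fix e :: real assume "e > 0"
  then obtain d where d: "d > 0" and *: "\<And>P. \<lbrakk>finite P; \<And>a b. (a, b) \<in> P \<Longrightarrow> a < b \<and> {a..b} \<subseteq> S;
           disjoint_family_on (\<lambda>(a, b). {a<..<b}) P; (\<Sum>(a, b)\<in>P. b - a) < d\<rbrakk>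
           \<Longrightarrow> (\<Sum>(a, b)\<in>P. \<bar>f b - f a\<bar>) < e"
    using abs_continuous_onD[OF assms(1)] by metis
  show "\<exists>d>0. \<forall>P. finite P \<and> (\<forall>(a, b)\<in>P. a < b \<and> {a..b} \<subseteq> S) \<and>
        disjoint_family_on (\<lambda>(a, b). {a<..<b}) P \<and> (\<Sum>(a, b)\<in>P. b - a) < d
        \<longrightarrow> (\<Sum>(a, b)\<in>P. \<bar>g b - g a\<bar>) < e"
  proof (intro exI[of _ d] conjI allI impI d)
    fix P assume P: "finite P \<and> (\<forall>(a, b)\<in>P. a < b \<and> {a..b} \<subseteq> S) \<and>
        disjoint_family_on (\<lambda>(a, b). {a<..<b}) P \<and> (\<Sum>(a, b)\<in>P. b - a) < d"
    have "(\<Sum>(a, b)\<in>P. \<bar>g b - g a\<bar>) = (\<Sum>(a, b)\<in>P. \<bar>f b - f a\<bar>)"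
    proof (rule sum.cong[OF refl], clarify)
      fix a b assume "(a, b) \<in> P"
      then have "a < b" "{a..b} \<subseteq> S" using P by auto
      then have "a \<in> S" "b \<in> S" by auto
      then show "\<bar>g b - g a\<bar> = \<bar>f b - f a\<bar>" by (simp add: assms(2))
    qed
    also have "\<dots> < e" using P by (intro *) auto
    finally show "(\<Sum>(a, b)\<in>P. \<bar>g b - g a\<bar>) < e" .
  qed
qed

text \<open>Common source of the closure properties used later: for Lipschitz functions, products of
  bounded factors and scalar multiples, increments are controlled by those of two absolutely
  continuous functions.\<close>

lemma abs_continuous_on_dominated:
  assumes f: "abs_continuous_on S f" and g: "abs_continuous_on S g"
    and B: "\<And>a b. a \<in> S \<Longrightarrow> b \<in> S \<Longrightarrow> \<bar>h b - h a\<bar> \<le> B * (\<bar>f b - f a\<bar> + \<bar>g b - g a\<bar>)"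
  shows "abs_continuous_on S h"
  unfolding abs_continuous_on_def
proof (intro allI impI)
  fix e :: real assume "e > 0"
  \<comment> \<open>A positive bound allows the division in \<open>e'\<close> and keeps the final
    inequality strict.\<close>
  define B' where "B' = max B 1"
  have B': "B' > 0" "B \<le> B'" by (auto simp: B'_def)
  define e' where "e' = e / (2 * B')"
  have "e' > 0" using \<open>e > 0\<close> B' by (simp add: e'_def)
  obtain d1 where d1: "d1 > 0" and *: "\<And>P. \<lbrakk>finite P; \<And>a b. (a, b) \<in> P \<Longrightarrow> a < b \<and> {a..b} \<subseteq> S;
           disjoint_family_on (\<lambda>(a, b). {a<..<b}) P; (\<Sum>(a, b)\<in>P. b - a) < d1\<rbrakk>
           \<Longrightarrow> (\<Sum>(a, b)\<in>P. \<bar>f b - f a\<bar>) < e'"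
    using abs_continuous_onD[OF f \<open>e' > 0\<close>] by metis
  obtain d2 where d2: "d2 > 0" and **: "\<And>P. \<lbrakk>finite P; \<And>a b. (a, b) \<in> P \<Longrightarrow> a < b \<and> {a..b} \<subseteq> S;
           disjoint_family_on (\<lambda>(a, b). {a<..<b}) P; (\<Sum>(a, b)\<in>P. b - a) < d2\<rbrakk>
           \<Longrightarrow> (\<Sum>(a, b)\<in>P. \<bar>g b - g a\<bar>) < e'"
    using abs_continuous_onD[OF g \<open>e' > 0\<close>] by metis
  show "\<exists>d>0. \<forall>P. finite P \<and> (\<forall>(a, b)\<in>P. a < b \<and> {a..b} \<subseteq> S) \<and>
        disjoint_family_on (\<lambda>(a, b). {a<..<b}) P \<and> (\<Sum>(a, b)\<in>P. b - a) < d
        \<longrightarrow> (\<Sum>(a, b)\<in>P. \<bar>h b - h a\<bar>) < e"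
  proof (intro exI[of _ "min d1 d2"] conjI allI impI)
    show "min d1 d2 > 0" using d1 d2 by simp
    fix P assume P: "finite P \<and> (\<forall>(a, b)\<in>P. a < b \<and> {a..b} \<subseteq> S) \<and>
        disjoint_family_on (\<lambda>(a, b). {a<..<b}) P \<and> (\<Sum>(a, b)\<in>P. b - a) < min d1 d2"
    have "(\<Sum>(a, b)\<in>P. \<bar>h b - h a\<bar>) \<le> (\<Sum>(a, b)\<in>P. B' * (\<bar>f b - f a\<bar> + \<bar>g b - g a\<bar>))"
    proof (rule sum_mono, clarify)
      fix a b assume "(a, b) \<in> P"
      then have "a < b" "{a..b} \<subseteq> S" using P by auto
      then have "a \<in> S" "b \<in> S" by auto
      then have "\<bar>h b - h a\<bar> \<le> B * (\<bar>f b - f a\<bar> + \<bar>g b - g a\<bar>)" by (rule B)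
      also have "\<dots> \<le> B' * (\<bar>f b - f a\<bar> + \<bar>g b - g a\<bar>)" using B'(2) by (intro mult_right_mono) auto
      finally show "\<bar>h b - h a\<bar> \<le> B' * (\<bar>f b - f a\<bar> + \<bar>g b - g a\<bar>)" .
    qed
    also have "\<dots> = B' * ((\<Sum>(a, b)\<in>P. \<bar>f b - f a\<bar>) + (\<Sum>(a, b)\<in>P. \<bar>g b - g a\<bar>))"
      by (simp add: split_def sum_distrib_left sum.distrib distrib_left)
    also have "\<dots> < B' * (e' + e')"
      using B'(1) P by (intro mult_strict_left_mono add_strict_mono * **) auto
    also have "\<dots> = e" using B' by (simp add: e'_def)
    finally show "(\<Sum>(a, b)\<in>P. \<bar>h b - h a\<bar>) < e" .
  qed
qed

lemma abs_continuous_on_ident: "abs_continuous_on S (\<lambda>x. x)"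
  unfolding abs_continuous_on_def
proof (intro allI impI)
  fix e :: real assume "e > 0"
  then show "\<exists>d>0. \<forall>P. finite P \<and> (\<forall>(a, b)\<in>P. a < b \<and> {a..b} \<subseteq> S) \<and>
        disjoint_family_on (\<lambda>(a, b). {a<..<b}) P \<and> (\<Sum>(a, b)\<in>P. b - a) < d
        \<longrightarrow> (\<Sum>(a, b)\<in>P. \<bar>b - a\<bar>) < e"
  proof (intro exI[of _ e] conjI allI impI)
    fix P assume P: "finite P \<and> (\<forall>(a, b)\<in>P. a < b \<and> {a..b} \<subseteq> S) \<and>
        disjoint_family_on (\<lambda>(a, b). {a<..<b}) P \<and> (\<Sum>(a, b)\<in>P. b - a) < e"
    have "(\<Sum>(a, b)\<in>P. \<bar>b - a\<bar>) = (\<Sum>(a, b)\<in>P. b - a)"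
      using P by (intro sum.cong) auto
    then show "(\<Sum>(a, b)\<in>P. \<bar>b - a\<bar>) < e" using P by simp
  qed
qed

lemma Lipschitz_imp_abs_continuous_on:
  assumes "\<And>a b. a \<in> S \<Longrightarrow> b \<in> S \<Longrightarrow> \<bar>f b - f a\<bar> \<le> B * \<bar>b - a\<bar>"
  shows "abs_continuous_on S f"
proof (rule abs_continuous_on_dominated[OF abs_continuous_on_ident abs_continuous_on_ident])
  fix a b assume "a \<in> S" "b \<in> S"
  then show "\<bar>f b - f a\<bar> \<le> B / 2 * (\<bar>b - a\<bar> + \<bar>b - a\<bar>)" using assms by simp
qed

lemma abs_continuous_on_mult:
  assumes f: "abs_continuous_on S f" and g: "abs_continuous_on S g"
    and Bf: "\<And>x. x \<in> S \<Longrightarrow> \<bar>f x\<bar> \<le> B" and Bg: "\<And>x. x \<in> S \<Longrightarrow> \<bar>g x\<bar> \<le> B"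
  shows "abs_continuous_on S (\<lambda>x. f x * g x)"
proof (rule abs_continuous_on_dominated[OF f g])
  fix a b assume ab: "a \<in> S" "b \<in> S"
  have "f b * g b - f a * g a = f b * (g b - g a) + g a * (f b - f a)"
    by (simp add: algebra_simps)
  then have "\<bar>f b * g b - f a * g a\<bar> \<le> \<bar>f b\<bar> * \<bar>g b - g a\<bar> + \<bar>g a\<bar> * \<bar>f b - f a\<bar>"
    by (metis abs_mult abs_triangle_ineq)
  also have "\<dots> \<le> B * \<bar>g b - g a\<bar> + B * \<bar>f b - f a\<bar>"
    using Bf Bg ab by (intro add_mono mult_right_mono) auto
  finally show "\<bar>f b * g b - f a * g a\<bar> \<le> B * (\<bar>f b - f a\<bar> + \<bar>g b - g a\<bar>)"
    by (simp add: algebra_simps)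
qed

lemma abs_continuous_on_imp_uniformly_continuous_on:
  assumes f: "abs_continuous_on S f" and S: "is_interval S"
  shows "uniformly_continuous_on S f"
  unfolding uniformly_continuous_on_def
proof (intro allI impI)
  fix e :: real assume "e > 0"
  then obtain d where d: "d > 0" and *: "\<And>P. \<lbrakk>finite P; \<And>a b. (a, b) \<in> P \<Longrightarrow> a < b \<and> {a..b} \<subseteq> S;
           disjoint_family_on (\<lambda>(a, b). {a<..<b}) P; (\<Sum>(a, b)\<in>P. b - a) < d\<rbrakk>
           \<Longrightarrow> (\<Sum>(a, b)\<in>P. \<bar>f b - f a\<bar>) < e"
    using abs_continuous_onD[OF f] by metis
  have **: "\<bar>f b - f a\<bar> < e" if "a < b" "a \<in> S" "b \<in> S" "b - a < d" for a b
  proof -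
    have "{a..b} \<subseteq> S"
      using S that by (meson atLeastAtMost_iff mem_is_interval_1_I subsetI)
    \<comment> \<open>Absolute continuity is applied to the family consisting of one
      interval.\<close>
    then show ?thesis
      using *[of "{(a, b)}"] that by (simp add: disjoint_family_on_def)
  qed
  have "dist (f x') (f x) < e" if "x \<in> S" "x' \<in> S" "dist x' x < d" for x x'
    using **[of x x'] **[of x' x] that \<open>e > 0\<close>
    by (cases x x' rule: linorder_cases) (auto simp: dist_real_def abs_minus_commute)
  then show "\<exists>d>0. \<forall>x\<in>S. \<forall>x'\<in>S. dist x' x < d \<longrightarrow> dist (f x') (f x) < e"
    using d by blast
qed

text \<open>Tags in the exceptional null set are confined to an open set of small measure, where
  absolute continuity bounds the increments; the other tags are handled as for \<open>C\<^sup>1\<close> functions.\<close>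

theorem fundamental_theorem_of_calculus_abs_continuous:
  fixes f f' :: "real \<Rightarrow> real"
  assumes "a \<le> b" and ac: "abs_continuous_on {a..b} f" and E: "negligible E"
    and vecd: "\<And>x. x \<in> {a..b} - E \<Longrightarrow> (f has_vector_derivative f' x) (at x within {a..b})"
  shows "(f' has_integral (f b - f a)) {a..b}"
proof -
  \<comment> \<open>With the value 0 on \<open>E\<close>, a tag in \<open>E\<close> contributes only
    an increment of \<open>f\<close>, which absolute continuity controls. The change on a negligible
    set is undone at the end.\<close>
  define D where "D x = (if x \<in> E then 0 else f' x)" for x
  have "(D has_integral (f b - f a)) (cbox a b)"
    unfolding has_integral
  proof (intro allI impI)
    fix e0 :: real assume "e0 > 0"
    \<comment> \<open>Tags off \<open>E\<close> will cost at most \<open>e * (b - a)\<close> and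
      tags in \<open>E\<close> less than \<open>e\<close>. The denominator leaves room for both and
      is positive even when \<open>a = b\<close>.\<close>
    define e where "e = e0 / (b - a + 2)"
    have e: "e > 0" using \<open>a \<le> b\<close> \<open>e0 > 0\<close> by (simp add: e_def)
    obtain \<delta> where \<delta>: "\<delta> > 0" and small: "\<And>P. \<lbrakk>finite P; \<And>u v. (u, v) \<in> P \<Longrightarrow> u < v \<and> {u..v} \<subseteq> {a..b};
           disjoint_family_on (\<lambda>(u, v). {u<..<v}) P; (\<Sum>(u, v)\<in>P. v - u) < \<delta>\<rbrakk>
           \<Longrightarrow> (\<Sum>(u, v)\<in>P. \<bar>f v - f u\<bar>) < e"
      using abs_continuous_onD[OF ac e] by metis
    have E0: "E \<in> null_sets lebesgue" using E by (simp add: negligible_iff_null_sets)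
    obtain T where T: "open T" "E \<subseteq> T" "(T - E) \<in> lmeasurable" "emeasure lebesgue (T - E) < ennreal \<delta>"
      using sets_lebesgue_outer_open[of E \<delta>] E0 \<delta> by blast
    have Tm: "T \<in> lmeasurable"
      using T E by (metis Diff_partition Un_Diff_cancel fmeasurable.Un negligible_imp_measurable sup.absorb2)
    have Td: "measure lebesgue T < \<delta>"
    proof -
      have "emeasure lebesgue (T - E) = emeasure lebesgue T"
        using E0 T by (intro emeasure_Diff_null_set) (auto intro: fmeasurableD Tm)
      then have "ennreal (measure lebesgue T) < ennreal \<delta>"
        using T Tm by (simp add: emeasure_eq_measure2)
      then show ?thesis using \<delta> by (simp add: ennreal_less_iff)
    qed
    have "\<exists>d>0. (x \<in> E \<longrightarrow> ball x d \<subseteq> T) \<and> (x \<in> {a..b} - E \<longrightarrow>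
         (\<forall>y\<in>{a..b}. norm (y-x) < d \<longrightarrow> norm (f y - f x - (y-x) *\<^sub>R f' x) \<le> e * norm (y-x)))" for x
    proof (cases "x \<in> E")
      case True
      then show ?thesis using T(1,2) by (metis DiffD2 openE subsetD)
    next
      case False
      show ?thesis
      proof (cases "x \<in> {a..b}")
        case True
        then show ?thesis
          using False vecd[unfolded has_vector_derivative_def has_derivative_within_alt] e by blast
      next
        case False
        with \<open>x \<notin> E\<close> show ?thesis by (intro exI[of _ 1]) auto
      qed
    qed
    then obtain d where d: "\<And>x. d x > 0" "\<And>x. x \<in> E \<Longrightarrow> ball x (d x) \<subseteq> T"
        "\<And>x y. \<lbrakk>x \<in> {a..b} - E; y \<in> {a..b}; norm (y-x) < d x\<rbrakk>
            \<Longrightarrow> norm (f y - f x - (y-x) *\<^sub>R f' x) \<le> e * norm (y-x)"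
      by metis
    show "\<exists>\<gamma>. gauge \<gamma> \<and> (\<forall>p. p tagged_division_of (cbox a b) \<and> \<gamma> fine p \<longrightarrow>
      norm ((\<Sum>(x, k)\<in>p. measure lborel k *\<^sub>R D x) - (f b - f a)) < e0)"
    proof (rule exI, safe)
      show "gauge (\<lambda>x. ball x (d x))"
        using d(1) gauge_ball_dependent by blast
    next
      fix p
      assume ptag: "p tagged_division_of cbox a b" and finep: "(\<lambda>x. ball x (d x)) fine p"
      have fin: "finite p" using ptag by auto
      have K: "\<exists>u v. K = {u..v} \<and> u \<le> x \<and> x \<le> v \<and> a \<le> u \<and> v \<le> b \<and> {u..v} \<subseteq> ball x (d x)"
        if "(x, K) \<in> p" for x K
      proof -
        have "x \<in> K" "K \<subseteq> cbox a b" using ptag that by blast+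
        moreover obtain u v where "K = cbox u v" using tagged_division_ofD(4)[OF ptag \<open>(x, K) \<in> p\<close>] by blast
        moreover have "K \<subseteq> ball x (d x)" using finep that by blast
        ultimately show ?thesis by (intro exI[of _ u] exI[of _ v]) auto
      qed
      have ba: "b - a = (\<Sum>(x,K)\<in>p. Sup K - Inf K)" "f b - f a = (\<Sum>(x,K)\<in>p. f(Sup K) - f(Inf K))"
        using additive_tagged_division_1[where f= "\<lambda>x. x"] additive_tagged_division_1[where f= f]
              \<open>a \<le> b\<close> ptag by auto
      \<comment> \<open>Degenerate intervals are left out because the definition of absolute
        continuity asks for \<open>a < b\<close>; their increments vanish anyway.\<close>
      define q where "q = {z \<in> p. fst z \<in> E \<and> Inf (snd z) < Sup (snd z)}"
      have qp: "q \<subseteq> p" by (auto simp: q_def)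
      have finq: "finite q" using fin qp finite_subset by blast
      define J where "J z = (Inf (snd z), Sup (snd z))" for z :: "real \<times> real set"
      have disj: "{Inf (snd z)<..<Sup (snd z)} \<inter> {Inf (snd z')<..<Sup (snd z')} = {}"
        if "z \<in> q" "z' \<in> q" "z \<noteq> z'" for z z'
      proof -
        obtain x K x' K' where z: "z = (x, K)" "z' = (x', K')" by (metis prod.collapse)
        have mem: "(x, K) \<in> p" "(x', K') \<in> p" using that qp z by auto
        have "interior K \<inter> interior K' = {}"
          using tagged_division_ofD(5)[OF ptag mem] that z by blast
        then show ?thesis using K[OF mem(1)] K[OF mem(2)] z by (auto simp: cInf_atLeastAtMost)
      qed
      \<comment> \<open>Absolute continuity speaks of a set of pairs of end points, so sums over
        \<open>q\<close> are transported along \<open>J\<close>. Two distinct members of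
        \<open>q\<close> with the same end points would give an open interval disjoint from itself,
        hence empty.\<close>
      have inj: "inj_on J q"
      proof (rule inj_onI, rule ccontr)
        fix z z' assume z: "z \<in> q" "z' \<in> q" "J z = J z'" "z \<noteq> z'"
        then have "{Inf (snd z)<..<Sup (snd z)} = {}"
          using disj[OF z(1,2,4)] by (simp add: J_def)
        then show False using z(1) by (auto simp: q_def)
      qed
      have "(\<Sum>z\<in>q. \<bar>f (Sup (snd z)) - f (Inf (snd z))\<bar>) = (\<Sum>(u, v)\<in>J ` q. \<bar>f v - f u\<bar>)"
        unfolding sum.reindex[OF inj] by (simp add: J_def)
      also have "\<dots> < e"
      proof (rule small)
        show "finite (J ` q)" using finq by simp
        show "u < v \<and> {u..v} \<subseteq> {a..b}" if uvJ: "(u, v) \<in> J ` q" for u v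
        proof -
          obtain x L where "(x, L) \<in> p" and uv: "u = Inf L" "v = Sup L" "u < v"
            using uvJ by (auto simp: J_def q_def)
          from K[OF this(1)] show ?thesis using uv by auto
        qed
        show "disjoint_family_on (\<lambda>(u, v). {u<..<v}) (J ` q)"
          unfolding disjoint_family_on_def by (auto simp: J_def dest: disj)
        have "(\<Sum>(u, v)\<in>J ` q. v - u) = (\<Sum>z\<in>q. measure lebesgue {Inf (snd z)<..<Sup (snd z)})"
          unfolding sum.reindex[OF inj]
        proof (rule sum.cong[OF refl])
          fix z assume "z \<in> q"
          then have "Inf (snd z) < Sup (snd z)" by (simp add: q_def)
          then show "((\<lambda>(u, v). v - u) \<circ> J) z = measure lebesgue {Inf (snd z)<..<Sup (snd z)}"
            by (simp add: J_def)
        qed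
        also have "\<dots> = measure lebesgue (\<Union>z\<in>q. {Inf (snd z)<..<Sup (snd z)})"
        proof (rule measure_finite_Union[symmetric, OF finq])
          show "disjoint_family_on (\<lambda>z. {Inf (snd z)<..<Sup (snd z)}) q"
            unfolding disjoint_family_on_def using disj by blast
          show "emeasure lebesgue {Inf (snd z)<..<Sup (snd z)} \<noteq> \<infinity>" if "z \<in> q" for z
            using that by (simp add: q_def)
        qed auto
        also have "\<dots> \<le> measure lebesgue T"
        proof (rule measure_mono_fmeasurable[OF _ _ Tm])
          show "(\<Union>z\<in>q. {Inf (snd z)<..<Sup (snd z)}) \<subseteq> T"
          proof (rule UN_least)
            fix z assume "z \<in> q"
            then obtain x L where z: "z = (x, L)" "(x, L) \<in> p" "x \<in> E"
              unfolding q_def by (cases z) auto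
            obtain u v where "L = {u..v}" "u \<le> x" "x \<le> v" "{u..v} \<subseteq> ball x (d x)"
              using K[OF z(2)] by blast
            then have "{u<..<v} \<subseteq> T" "Inf (snd z) = u" "Sup (snd z) = v"
              using subset_trans[OF greaterThanLessThan_subseteq_atLeastAtMost_iff[THEN iffD2], of u v u v]
                d(2)[OF z(3)] z(1) by (auto intro: subset_trans)
            then show "{Inf (snd z)<..<Sup (snd z)} \<subseteq> T" by simp
          qed
          show "(\<Union>z\<in>q. {Inf (snd z)<..<Sup (snd z)}) \<in> sets lebesgue"
            using finq by auto
        qed
        finally show "(\<Sum>(u, v)\<in>J ` q. v - u) < \<delta>" using Td by simp
      qed
      finally have bound_q: "(\<Sum>z\<in>q. \<bar>f (Sup (snd z)) - f (Inf (snd z))\<bar>) < e" .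
      have "norm ((\<Sum>(x, k)\<in>p. measure lborel k *\<^sub>R D x) - (f b - f a)) =
            norm (\<Sum>(x, K) \<in> p. (measure lborel K *\<^sub>R D x) - (f (Sup K) - f (Inf K)))"
        by (simp add: ba(2) split_def sum_subtractf)
      also have "\<dots> \<le> (\<Sum>z\<in>p. e * (Sup (snd z) - Inf (snd z)) +
             (if z \<in> q then \<bar>f (Sup (snd z)) - f (Inf (snd z))\<bar> else 0))"
      proof (rule sum_norm_le, safe)
        fix x L assume xL: "(x, L) \<in> p"
        obtain u v where L: "L = {u..v}" and uv: "u \<le> x" "x \<le> v" "a \<le> u" "v \<le> b" "{u..v} \<subseteq> ball x (d x)"
          using K[OF xL] by blast
        have SI: "Sup L = v" "Inf L = u" "measure lborel L = v - u" using L uv by auto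
        show "norm (measure lborel L *\<^sub>R D x - (f (Sup L) - f (Inf L)))
            \<le> e * (Sup (snd (x, L)) - Inf (snd (x, L))) +
               (if (x, L) \<in> q then \<bar>f (Sup (snd (x, L))) - f (Inf (snd (x, L)))\<bar> else 0)"
        proof (cases "x \<in> E")
          case True
          show ?thesis
          proof (cases "u < v")
            case True
            then have "(x, L) \<in> q" using \<open>x \<in> E\<close> xL SI by (simp add: q_def)
            then show ?thesis using SI \<open>x \<in> E\<close> e True by (simp add: D_def abs_minus_commute)
          next
            case False
            then have "u = v" using uv by simp
            then show ?thesis using SI \<open>x \<in> E\<close> by (simp add: D_def)
          qed
        next
          case False
          have xab: "x \<in> {a..b} - E" using False uv by auto
          have "u \<in> {u..v}" "v \<in> {u..v}" using uv by auto
          then have "u \<in> ball x (d x)" "v \<in> ball x (d x)" using uv(5) by blast+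
          then have "norm (u - x) < d x" "norm (v - x) < d x"
            by (auto simp: dist_real_def)
          then have "norm (f u - f x - (u-x) *\<^sub>R f' x) \<le> e * norm (u-x)"
            "norm (f v - f x - (v-x) *\<^sub>R f' x) \<le> e * norm (v-x)"
            using d(3)[OF xab, of u] d(3)[OF xab, of v] uv by auto
          \<comment> \<open>Both end points are compared with the tag, which lies between them, so
            the two errors add up to at most \<open>e\<close> times the length.\<close>
          moreover have eq: "(v - u) *\<^sub>R f' x - (f v - f u) = 
              (f u - f x - (u-x) *\<^sub>R f' x) - (f v - f x - (v-x) *\<^sub>R f' x)"
            by (simp add: algebra_simps)
          ultimately have "norm ((v - u) *\<^sub>R f' x - (f v - f u)) \<le> e * norm (u-x) + e * norm (v-x)"
            unfolding eq using norm_triangle_ineq4[of "f u - f x - (u-x) *\<^sub>R f' x" "f v - f x - (v-x) *\<^sub>R f' x"]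
            by linarith
          also have "\<dots> = e * (v - u)" using uv by (simp add: algebra_simps)
          finally have "norm ((v - u) *\<^sub>R f' x - (f v - f u)) \<le> e * (v - u)" .
          moreover have "(x, L) \<notin> q" using False by (simp add: q_def)
          ultimately show ?thesis using SI False by (simp add: D_def)
        qed
      qed
      also have "\<dots> = e * (b - a) + (\<Sum>z\<in>q. \<bar>f (Sup (snd z)) - f (Inf (snd z))\<bar>)"
      proof -
        have "(\<Sum>z\<in>p. if z \<in> q then \<bar>f (Sup (snd z)) - f (Inf (snd z))\<bar> else 0) =
            (\<Sum>z\<in>q. \<bar>f (Sup (snd z)) - f (Inf (snd z))\<bar>)"
          using sum.inter_restrict[OF fin, of "\<lambda>z. \<bar>f (Sup (snd z)) - f (Inf (snd z))\<bar>" q] qp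
          by (simp add: inf.absorb2)
        then show ?thesis by (simp add: sum.distrib ba(1) sum_distrib_left split_def)
      qed
      also have "\<dots> < e * (b - a) + e" using bound_q by simp
      also have "\<dots> = e * (b - a + 1)" by (simp add: algebra_simps)
      also have "\<dots> < e * (b - a + 2)" using e by simp
      also have "\<dots> = e0" using \<open>a \<le> b\<close> by (simp add: e_def)
      finally show "norm ((\<Sum>(x, k)\<in>p. measure lborel k *\<^sub>R D x) - (f b - f a)) < e0" .
    qed
  qed
  then have "(D has_integral (f b - f a)) {a..b}" by simp
  then show ?thesis
    by (rule has_integral_spike[OF E, rotated]) (simp add: D_def)
qed

section \<open>The space \<open>L\<^sub>2\<close> and its bounded functionals\<close>

lemma L2_on_mult_integrable:
  assumes "f \<in> L2_on S" "g \<in> L2_on S"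
  shows "integrable (lebesgue_on S) (\<lambda>x. f x * g x)"
proof (rule Bochner_Integration.integrable_bound)
  show "integrable (lebesgue_on S) (\<lambda>x. (f x)\<^sup>2 + (g x)\<^sup>2)"
    using assms by (auto simp: L2_on_def)
  show "(\<lambda>x. f x * g x) \<in> borel_measurable (lebesgue_on S)"
    using assms by (auto simp: L2_on_def)
  have "\<bar>f x * g x\<bar> \<le> (f x)\<^sup>2 + (g x)\<^sup>2" for x
  proof -
    have "2 * (\<bar>f x\<bar> * \<bar>g x\<bar>) \<le> (f x)\<^sup>2 + (g x)\<^sup>2"
      using sum_squares_bound[of "\<bar>f x\<bar>" "\<bar>g x\<bar>"] by (simp add: mult.assoc)
    moreover have "0 \<le> \<bar>f x\<bar> * \<bar>g x\<bar>" by simp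
    ultimately show ?thesis unfolding abs_mult by linarith
  qed
  then show "AE x in lebesgue_on S. norm (f x * g x) \<le> norm ((f x)\<^sup>2 + (g x)\<^sup>2)"
    by simp
qed

lemma L2_on_add:
  assumes "f \<in> L2_on S" "g \<in> L2_on S"
  shows "(\<lambda>x. f x + g x) \<in> L2_on S"
proof -
  have "integrable (lebesgue_on S) (\<lambda>x. (f x)\<^sup>2 + (g x)\<^sup>2 + 2 * (f x * g x))"
    using assms L2_on_mult_integrable[OF assms]
    by (intro Bochner_Integration.integrable_add integrable_mult_right) (auto simp: L2_on_def)
  then show ?thesis
    using assms by (auto simp: L2_on_def power2_sum algebra_simps)
qed

lemma L2_on_cmult: "f \<in> L2_on S \<Longrightarrow> (\<lambda>x. c * f x) \<in> L2_on S"
  by (auto simp: L2_on_def power_mult_distrib)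

lemma L2_on_bounded:
  assumes "f \<in> borel_measurable (lebesgue_on S)" "S \<in> lmeasurable" "\<And>x. x \<in> S \<Longrightarrow> \<bar>f x\<bar> \<le> B"
  shows "f \<in> L2_on S"
proof -
  interpret finite_measure "lebesgue_on S" by (rule finite_measure_lebesgue_on[OF assms(2)])
  have "integrable (lebesgue_on S) (\<lambda>x. (f x)\<^sup>2)"
  proof (rule integrable_const_bound[where B = "B\<^sup>2"])
    show "AE x in lebesgue_on S. norm ((f x)\<^sup>2) \<le> B\<^sup>2"
      using assms(3) by (intro AE_I2) (force simp: abs_le_square_iff[symmetric])
  qed (use assms in auto)
  then show ?thesis using assms by (simp add: L2_on_def)
qed

lemma L2_continuous_on:
  assumes "continuous_on {-1..1} f"
  shows "f \<in> L2"
proof -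
  have "bounded (f ` {-1..1})"
    using assms by (intro compact_imp_bounded compact_continuous_image) auto
  then obtain B where "\<forall>y\<in>f ` {-1..1}. norm y \<le> B"
    unfolding bounded_iff by blast
  then have "\<And>x. x \<in> {-1..1} \<Longrightarrow> \<bar>f x\<bar> \<le> B" by auto
  then show ?thesis
    using assms by (intro L2_on_bounded continuous_imp_measurable_on_sets_lebesgue) auto
qed

text \<open>Derivatives are controlled only off a finite set (in the application the end points and
  \<open>t\<close>). This lemma and the two on \<open>L2_on\<close> and \<open>L2_norm\<close> below
  make the unspecified values there harmless.\<close>

lemma lebesgue_on_integral_finite_difference:
  fixes f g :: "real \<Rightarrow> real"
  assumes "S \<in> sets lebesgue" "finite X" "\<And>x. x \<in> S - X \<Longrightarrow> f x = g x"
  shows "integral\<^sup>L (lebesgue_on S) f = integral\<^sup>L (lebesgue_on S) g"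
proof (rule integral_discrete_difference[where X = "X \<inter> S"])
  show "emeasure (lebesgue_on S) {x} = 0" if "x \<in> X \<inter> S" for x
    using that assms(1) by (subst emeasure_restrict_space) auto
  show "{x} \<in> sets (lebesgue_on S)" if "x \<in> X \<inter> S" for x
    using that assms(1) by (auto simp: sets_restrict_space_iff)
qed (use assms in \<open>auto intro: countable_finite\<close>)

lemma L2_on_finite_difference:
  assumes "f \<in> L2_on S" "S \<in> sets lebesgue" "finite X" "\<And>x. x \<in> S - X \<Longrightarrow> f x = g x"
  shows "g \<in> L2_on S"
proof -
  have s: "{x} \<in> sets (lebesgue_on S)" if "x \<in> X \<inter> S" for x
    using that assms(2) by (auto simp: sets_restrict_space_iff)
  have n: "emeasure (lebesgue_on S) {x} = 0" if "x \<in> X \<inter> S" for x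
    using that assms(2) by (subst emeasure_restrict_space) auto
  have c: "countable (X \<inter> S)" using assms(3) by (auto intro: countable_finite)
  have "g \<in> borel_measurable (lebesgue_on S)"
    by (rule measurable_discrete_difference[where X = "X \<inter> S" and f = f])
       (use assms c s in \<open>auto simp: L2_on_def\<close>)
  moreover have "integrable (lebesgue_on S) (\<lambda>x. (g x)\<^sup>2)"
  proof (rule integrable_discrete_difference[where X = "X \<inter> S" and g = "\<lambda>x. (f x)\<^sup>2", THEN iffD2])
    show "integrable (lebesgue_on S) (\<lambda>x. (f x)\<^sup>2)" using assms(1) by (simp add: L2_on_def)
  qed (use assms c s n in auto)
  ultimately show ?thesis by (simp add: L2_on_def)
qed

lemma L2_norm_finite_difference:
  assumes "finite X" "\<And>x. x \<in> {-1..1} - X \<Longrightarrow> f x = g x"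
  shows "L2_norm f = L2_norm g"
  unfolding L2_norm_def
  using lebesgue_on_integral_finite_difference[of "{-1..1}" X "\<lambda>x. \<bar>f x\<bar>\<^sup>2" "\<lambda>x. \<bar>g x\<bar>\<^sup>2"] assms
  by simp

lemma L2_norm_power2: "(L2_norm f)\<^sup>2 = (LINT x|lebesgue_on {-1..1}. f x * f x)"
  by (simp add: L2_norm_def power2_eq_square)

lemma L2_norm_nonneg: "L2_norm f \<ge> 0"
  by (simp add: L2_norm_def)

lemma L2_norm_cmult: "L2_norm (\<lambda>x. c * f x) = \<bar>c\<bar> * L2_norm f"
  by (simp add: L2_norm_def power_mult_distrib real_sqrt_mult)

lemma L2_norm_add_power2:
  assumes "f \<in> L2" "g \<in> L2"
  shows "(L2_norm (\<lambda>x. f x + e * g x))\<^sup>2 =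
    (L2_norm f)\<^sup>2 + 2 * e * (LINT x|lebesgue_on {-1..1}. f x * g x) + e\<^sup>2 * (L2_norm g)\<^sup>2"
proof -
  have "(f x + e * g x) * (f x + e * g x) = f x * f x + 2 * e * (f x * g x) + e\<^sup>2 * (g x * g x)" for x
    by (simp add: algebra_simps power2_eq_square)
  then show ?thesis
    using L2_on_mult_integrable[OF assms(1,1)] L2_on_mult_integrable[OF assms]
      L2_on_mult_integrable[OF assms(2,2)]
    by (simp add: L2_norm_power2)
qed

text \<open>The squared norm of \<open>f + e * g\<close> is a nonnegative quadratic in
  \<open>e\<close>. The leading coefficient may vanish without \<open>g\<close> being the zero
  function, so the affine case is treated separately.\<close>

lemma L2_Cauchy_Schwarz:
  assumes "f \<in> L2" "g \<in> L2"
  shows "\<bar>LINT x|lebesgue_on {-1..1}. f x * g x\<bar> \<le> L2_norm f * L2_norm g"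
proof -
  define p where "p = (LINT x|lebesgue_on {-1..1}. f x * g x)"
  have q: "0 \<le> (L2_norm f)\<^sup>2 + 2 * e * p + e\<^sup>2 * (L2_norm g)\<^sup>2" for e
    using L2_norm_add_power2[OF assms, of e] by (simp add: p_def[symmetric]) (metis zero_le_power2)
  have "p\<^sup>2 \<le> (L2_norm f)\<^sup>2 * (L2_norm g)\<^sup>2"
  proof (cases "L2_norm g = 0")
    case True
    have "p = 0"
    proof (rule ccontr)
      assume "p \<noteq> 0"
      \<comment> \<open>At this \<open>e\<close> the affine expression equals -1.\<close>
      then show False
        using q[of "- ((L2_norm f)\<^sup>2 + 1) / (2 * p)"] True by (simp add: field_simps)
    qed
    then show ?thesis by simp
  next
    case False
    define c where "c = (L2_norm g)\<^sup>2"
    have "c > 0" using False by (simp add: c_def)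
    \<comment> \<open>The quadratic is evaluated at its minimiser.\<close>
    moreover have "0 \<le> (L2_norm f)\<^sup>2 + 2 * (- p / c) * p + (- p / c)\<^sup>2 * c"
      using q[of "- p / c"] unfolding c_def .
    ultimately have "0 \<le> (L2_norm f)\<^sup>2 - p\<^sup>2 / c" by (simp add: power2_eq_square)
    then show ?thesis using \<open>c > 0\<close> by (simp add: field_simps flip: c_def)
  qed
  then have "p\<^sup>2 \<le> (L2_norm f * L2_norm g)\<^sup>2" by (simp add: power_mult_distrib)
  then have "\<bar>p\<bar> \<le> \<bar>L2_norm f * L2_norm g\<bar>" by (simp add: abs_le_square_iff)
  then show ?thesis by (simp add: p_def abs_mult L2_norm_nonneg)
qed

lemma functional_norm_bound:
  assumes S: "bounded_functional S" and f: "f \<in> L2"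
  shows "\<bar>S f\<bar> \<le> functional_norm S * L2_norm f"
proof -
  obtain C where C: "\<And>f. f \<in> L2 \<Longrightarrow> \<bar>S f\<bar> \<le> C * L2_norm f"
    using S unfolding bounded_functional_def by blast
  show ?thesis
  proof (cases "L2_norm f = 0")
    case True
    then show ?thesis using C[OF f] by simp
  next
    case False
    then have pos: "L2_norm f > 0" using L2_norm_nonneg[of f] by simp
    define g where "g = (\<lambda>x. (1 / L2_norm f) * f x)"
    have g: "g \<in> L2" "L2_norm g \<le> 1"
      using pos L2_on_cmult[OF f, of "1 / L2_norm f"] L2_norm_cmult[of "1 / L2_norm f" f]
      by (auto simp: g_def)
    \<comment> \<open>A real-valued supremum is an upper bound of its set only if the set is bounded
      above; the boundedness of \<open>S\<close> provides this.\<close>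
    have bdd: "bdd_above ((\<lambda>f. \<bar>S f\<bar>) ` {f \<in> L2. L2_norm f \<le> 1})"
    proof (rule bdd_aboveI2)
      fix h assume "h \<in> {f \<in> L2. L2_norm f \<le> 1}"
      then have "\<bar>S h\<bar> \<le> C * L2_norm h" "L2_norm h \<le> 1" using C by auto
      moreover have "C * L2_norm h \<le> \<bar>C\<bar> * 1"
        using calculation L2_norm_nonneg[of h] by (intro mult_mono) auto
      ultimately show "\<bar>S h\<bar> \<le> \<bar>C\<bar>" by simp
    qed
    have "\<bar>S g\<bar> \<le> functional_norm S"
      unfolding functional_norm_def by (rule cSUP_upper[OF _ bdd]) (use g in auto)
    moreover have "S g = (1 / L2_norm f) * S f"
      using S f by (simp add: bounded_functional_def g_def del: times_divide_eq_left)
    ultimately show ?thesis using pos by (simp add: field_simps abs_mult)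
  qed
qed

lemma bounded_functional_integral:
  assumes w: "w \<in> L2"
  shows "bounded_functional (\<lambda>f. LINT x|lebesgue_on {-1..1}. w x * f x)"
    and "functional_norm (\<lambda>f. LINT x|lebesgue_on {-1..1}. w x * f x) \<le> L2_norm w"
proof -
  show "bounded_functional (\<lambda>f. LINT x|lebesgue_on {-1..1}. w x * f x)"
    unfolding bounded_functional_def
  proof (intro conjI ballI allI)
    fix f g assume "f \<in> L2" "g \<in> L2"
    then show "(LINT x|lebesgue_on {-1..1}. w x * (f x + g x)) =
        (LINT x|lebesgue_on {-1..1}. w x * f x) + (LINT x|lebesgue_on {-1..1}. w x * g x)"
      using L2_on_mult_integrable[OF w] by (simp add: distrib_left)
  next
    fix c f
    have "(\<lambda>x. w x * (c * f x)) = (\<lambda>x. c * (w x * f x))" by (simp add: algebra_simps)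
    then show "(LINT x|lebesgue_on {-1..1}. w x * (c * f x)) = c * (LINT x|lebesgue_on {-1..1}. w x * f x)"
      by simp
  next
    show "\<exists>C. \<forall>f\<in>L2. \<bar>LINT x|lebesgue_on {-1..1}. w x * f x\<bar> \<le> C * L2_norm f"
    proof (intro exI[of _ "L2_norm w"] ballI)
      fix f assume "f \<in> L2"
      then show "\<bar>LINT x|lebesgue_on {-1..1}. w x * f x\<bar> \<le> L2_norm w * L2_norm f"
        by (rule L2_Cauchy_Schwarz[OF w])
    qed
  qed
  show "functional_norm (\<lambda>f. LINT x|lebesgue_on {-1..1}. w x * f x) \<le> L2_norm w"
    unfolding functional_norm_def
  proof (rule cSUP_least)
    have "(\<lambda>x. 0) \<in> {f \<in> L2. L2_norm f \<le> 1}" by (auto simp: L2_on_def L2_norm_def)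
    then show "{f \<in> L2. L2_norm f \<le> 1} \<noteq> {}" by blast
    fix f assume "f \<in> {f \<in> L2. L2_norm f \<le> 1}"
    then have "\<bar>LINT x|lebesgue_on {-1..1}. w x * f x\<bar> \<le> L2_norm w * L2_norm f" "L2_norm f \<le> 1"
      using L2_Cauchy_Schwarz[OF w] by auto
    then show "\<bar>LINT x|lebesgue_on {-1..1}. w x * f x\<bar> \<le> L2_norm w"
      using mult_left_le[OF _ L2_norm_nonneg[of w], of "L2_norm f"] by linarith
  qed
qed

text \<open>A first variation argument: the squared bound for \<open>S\<close> at
  \<open>w + e * g\<close> minus the squared value of \<open>S\<close> there is nonnegative in
  \<open>e\<close> and vanishes at \<open>e = 0\<close>, so its linear coefficient vanishes. Up to a
  nonzero factor, that coefficient is the difference of the two sides of the claim.\<close>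

lemma functional_eq_if_norm_attained:
  assumes S: "bounded_functional S" "functional_norm S \<le> L2_norm w" and w: "w \<in> L2"
    and att: "S w = (L2_norm w)\<^sup>2" and g: "g \<in> L2"
  shows "S g = (LINT x|lebesgue_on {-1..1}. w x * g x)"
proof -
  define N where "N = L2_norm w"
  define p where "p = (LINT x|lebesgue_on {-1..1}. w x * g x)"
  have N0: "N \<ge> 0" by (simp add: N_def L2_norm_nonneg)
  have bound: "\<bar>S f\<bar> \<le> N * L2_norm f" if "f \<in> L2" for f
    using functional_norm_bound[OF S(1) that] mult_right_mono[OF S(2) L2_norm_nonneg[of f]]
    by (simp add: N_def)
  show ?thesis
  proof (cases "N = 0")
    case True
    then show ?thesis
      using bound[OF g] L2_Cauchy_Schwarz[OF w g] by (simp add: N_def)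
  next
    case False
    define C where "C = N\<^sup>2 * (L2_norm g)\<^sup>2"
    have quad: "2 * e * (N\<^sup>2 * (S g - p)) \<le> e\<^sup>2 * C" for e
    proof -
      have eg: "(\<lambda>x. e * g x) \<in> L2" using g by (rule L2_on_cmult)
      have "S (\<lambda>x. w x + e * g x) = N\<^sup>2 + e * S g"
        using S(1) w g eg att unfolding bounded_functional_def N_def by simp
      then have "\<bar>N\<^sup>2 + e * S g\<bar> \<le> N * L2_norm (\<lambda>x. w x + e * g x)"
        using bound[OF L2_on_add[OF w eg]] by simp
      from power_mono[OF this abs_ge_zero, of 2]
      have "(N\<^sup>2 + e * S g)\<^sup>2 \<le> (N * L2_norm (\<lambda>x. w x + e * g x))\<^sup>2"
        by simp
      also have "\<dots> = N\<^sup>2 * (N\<^sup>2 + 2 * e * p + e\<^sup>2 * (L2_norm g)\<^sup>2)"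
        by (simp add: power_mult_distrib L2_norm_add_power2[OF w g] N_def p_def)
      finally have "2 * e * (N\<^sup>2 * (S g - p)) + (e * S g)\<^sup>2 \<le> e\<^sup>2 * C"
        by (simp add: C_def power2_eq_square algebra_simps)
      then show ?thesis by (smt (verit) zero_le_power2)
    qed
    define q where "q = N\<^sup>2 * (S g - p)"
    have C0: "C \<ge> 0" by (simp add: C_def)
    have "q = 0"
    proof (rule ccontr)
      assume "q \<noteq> 0"
      \<comment> \<open>This \<open>e\<close> has the sign of \<open>q\<close> and is small enough
        for the linear term, equal to \<open>2 * e\<^sup>2 * (C + 1)\<close>, to exceed the
        quadratic term \<open>e\<^sup>2 * C\<close>.\<close>
      define e where "e = q / (C + 1)"
      have "2 * e * q \<le> e\<^sup>2 * C" using quad[of e] by (simp add: q_def)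
      moreover have "2 * e * q = 2 * e\<^sup>2 * (C + 1)"
        using C0 by (simp add: e_def power2_eq_square)
      moreover have "e\<^sup>2 > 0" using \<open>q \<noteq> 0\<close> C0 by (simp add: e_def)
      ultimately have "2 * (C + 1) \<le> C" by (simp add: mult.assoc mult.left_commute[of 2])
      then show False using C0 by simp
    qed
    then show ?thesis using False by (simp add: q_def p_def)
  qed
qed

section \<open>Integration by parts and derivatives in \<open>L\<^sub>2\<^sup>r\<close>\<close>

lemma bounded_derivative_imp_Lipschitz:
  fixes f f' :: "real \<Rightarrow> real"
  assumes "convex S" "\<And>x. x \<in> S \<Longrightarrow> (f has_vector_derivative f' x) (at x within S)"
    "\<And>x. x \<in> S \<Longrightarrow> \<bar>f' x\<bar> \<le> B" "a \<in> S" "b \<in> S"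
  shows "\<bar>f b - f a\<bar> \<le> B * \<bar>b - a\<bar>"
  using field_differentiable_bound[of S f f' B b a] assms
  by (simp add: has_real_derivative_iff_has_vector_derivative)

text \<open>The pieces of \<open>u\<close> live on open intervals and are known at the ends only
  through limits. The fundamental theorem is therefore used on compact subintervals, and the ends
  are reached by continuity of the indefinite integral.\<close>

lemma integration_by_parts_abs_continuous:
  fixes p q p' q' :: "real \<Rightarrow> real"
  assumes "\<alpha> < \<beta>" and acp: "abs_continuous_on {\<alpha><..<\<beta>} p" and acq: "abs_continuous_on {\<alpha><..<\<beta>} q"
    and E: "negligible E"
    and dp: "\<And>x. x \<in> {\<alpha><..<\<beta>} - E \<Longrightarrow> (p has_vector_derivative p' x) (at x)"
    and dq: "\<And>x. x \<in> {\<alpha><..<\<beta>} - E \<Longrightarrow> (q has_vector_derivative q' x) (at x)"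
    and int: "(\<lambda>x. p' x * q x + p x * q' x) integrable_on {\<alpha>..\<beta>}"
    and lim\<alpha>: "((\<lambda>x. p x * q x) \<longlongrightarrow> L\<alpha>) (at_right \<alpha>)"
    and lim\<beta>: "((\<lambda>x. p x * q x) \<longlongrightarrow> L\<beta>) (at_left \<beta>)"
  shows "integral {\<alpha>..\<beta>} (\<lambda>x. p' x * q x + p x * q' x) = L\<beta> - L\<alpha>"
proof -
  define h where "h = (\<lambda>x. p' x * q x + p x * q' x)"
  define F where "F x = integral {\<alpha>..x} h" for x
  have int: "h integrable_on {\<alpha>..\<beta>}" using int by (simp add: h_def)
  have unif: "uniformly_continuous_on {\<alpha><..<\<beta>} p" "uniformly_continuous_on {\<alpha><..<\<beta>} q"
    using acp acq by (auto intro: abs_continuous_on_imp_uniformly_continuous_on)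
  then have "bounded (p ` {\<alpha><..<\<beta>})" "bounded (q ` {\<alpha><..<\<beta>})"
    by (auto intro!: bounded_uniformly_continuous_image intro: bounded_subset[OF bounded_closed_interval[of \<alpha> \<beta>]])
  then obtain B1 B2 where B1: "\<forall>y\<in>p ` {\<alpha><..<\<beta>}. norm y \<le> B1" and B2: "\<forall>y\<in>q ` {\<alpha><..<\<beta>}. norm y \<le> B2"
    unfolding bounded_iff by blast
  have ac: "abs_continuous_on {\<alpha><..<\<beta>} (\<lambda>x. p x * q x)"
    by (rule abs_continuous_on_mult[OF acp acq, of "max B1 B2"]) (use B1 B2 in \<open>auto simp: le_max_iff_disj\<close>)
  have ftc: "p b * q b - p a * q a = F b - F a" if ab: "\<alpha> < a" "a \<le> b" "b < \<beta>" for a b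
  proof -
    have "(h has_integral (p b * q b - p a * q a)) {a..b}"
    proof (rule fundamental_theorem_of_calculus_abs_continuous[OF ab(2) _ E])
      show "abs_continuous_on {a..b} (\<lambda>x. p x * q x)"
        by (rule abs_continuous_on_subset[OF ac]) (use ab in auto)
      fix x assume x: "x \<in> {a..b} - E"
      have "((\<lambda>x. p x * q x) has_vector_derivative (p x * q' x + p' x * q x)) (at x)"
        by (rule has_vector_derivative_mult) (use dp dq x ab in auto)
      then show "((\<lambda>x. p x * q x) has_vector_derivative h x) (at x within {a..b})"
        by (auto simp: h_def add.commute intro: has_vector_derivative_at_within)
    qed
    then have "integral {a..b} h = p b * q b - p a * q a" by (rule integral_unique)
    moreover have "integral {\<alpha>..a} h + integral {a..b} h = integral {\<alpha>..b} h"
      using ab by (intro Henstock_Kurzweil_Integration.integral_combine integrable_subinterval_real[OF int]) auto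
    ultimately show ?thesis by (simp add: F_def)
  qed
  have contF: "continuous_on {\<alpha>..\<beta>} F"
    unfolding F_def using int by (rule indefinite_integral_continuous_1)
  define m where "m = (\<alpha> + \<beta>) / 2"
  have m: "\<alpha> < m" "m < \<beta>" using \<open>\<alpha> < \<beta>\<close> by (auto simp: m_def)
  \<comment> \<open>On the open interval the product differs from \<open>F\<close> by this constant,
    so its one-sided limits are \<open>c\<close> plus the end values of \<open>F\<close>.\<close>
  define c where "c = p m * q m - F m"
  have pq: "p x * q x = c + F x" if "x \<in> {\<alpha><..<\<beta>}" for x
    using ftc[of x m] ftc[of m x] that m by (cases "x \<le> m") (auto simp: c_def)
  have "at_right \<alpha> = at \<alpha> within {\<alpha>..\<beta>}"
    using \<open>\<alpha> < \<beta>\<close> by (simp add: at_within_Icc_at_right)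
  moreover have "(F \<longlongrightarrow> F \<alpha>) (at \<alpha> within {\<alpha>..\<beta>})"
    using contF \<open>\<alpha> < \<beta>\<close> by (auto simp: continuous_on_def)
  ultimately have "((\<lambda>x. c + F x) \<longlongrightarrow> c + F \<alpha>) (at_right \<alpha>)"
    by (auto intro: tendsto_intros)
  then have "((\<lambda>x. p x * q x) \<longlongrightarrow> c + F \<alpha>) (at_right \<alpha>)"
    by (rule Lim_transform_eventually)
       (use pq m in \<open>auto simp: eventually_at_right intro!: exI[of _ \<beta>]\<close>)
  with lim\<alpha> have 1: "L\<alpha> = c + F \<alpha>"
    using tendsto_unique trivial_limit_at_right_real by blast
  have "at_left \<beta> = at \<beta> within {\<alpha>..\<beta>}"
    using \<open>\<alpha> < \<beta>\<close> by (simp add: at_within_Icc_at_left)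
  moreover have "(F \<longlongrightarrow> F \<beta>) (at \<beta> within {\<alpha>..\<beta>})"
    using contF \<open>\<alpha> < \<beta>\<close> by (auto simp: continuous_on_def)
  ultimately have "((\<lambda>x. c + F x) \<longlongrightarrow> c + F \<beta>) (at_left \<beta>)"
    by (auto intro: tendsto_intros)
  then have "((\<lambda>x. p x * q x) \<longlongrightarrow> c + F \<beta>) (at_left \<beta>)"
    by (rule Lim_transform_eventually)
       (use pq m in \<open>auto simp: eventually_at_left intro!: exI[of _ \<alpha>]\<close>)
  with lim\<beta> have 2: "L\<beta> = c + F \<beta>"
    using tendsto_unique trivial_limit_at_left_real by blast
  have "F \<alpha> = 0" by (simp add: F_def)
  with 1 2 show ?thesis by (simp add: F_def h_def)
qed

section \<open>Iterated derivatives and chains of derivatives\<close>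

lemma nderiv_on_0 [simp]: "nderiv_on S 0 f = f"
  by (simp add: nderiv_on_def)

lemma nderiv_on_Suc:
  "nderiv_on S (Suc j) f x = vector_derivative (nderiv_on S j f) (at x within S)"
  by (simp add: nderiv_on_def)

lemma differentiable_imp_has_nderiv_on:
  "nderiv_on S j f differentiable (at x within S) \<Longrightarrow>
    (nderiv_on S j f has_vector_derivative nderiv_on S (Suc j) f x) (at x within S)"
  by (simp add: nderiv_on_Suc vector_derivative_works)

text \<open>The regularity of \<open>u\<close> is assumed on each piece separately, while
  \<open>pderivs\<close> differentiates on their union; the two agree because differentiation is
  local on open sets.\<close>

lemma nderiv_on_open_subset:
  assumes "open S" "open T" "S \<subseteq> T" "x \<in> S"
  shows "nderiv_on S j f x = nderiv_on T j f x"
  using assms(4)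
proof (induction j arbitrary: x)
  case (Suc j)
  have "(nderiv_on S j f has_vector_derivative y) (at x) \<longleftrightarrow>
        (nderiv_on T j f has_vector_derivative y) (at x)" for y
    using has_vector_derivative_transform_within_open[of "nderiv_on S j f" y x S "nderiv_on T j f"]
      has_vector_derivative_transform_within_open[of "nderiv_on T j f" y x S "nderiv_on S j f"]
      Suc assms(1) by auto
  moreover have "at x within S = at x" "at x within T = at x"
    using assms Suc.prems at_within_open by blast+
  ultimately show ?case by (simp add: nderiv_on_Suc vector_derivative_def)
qed simp

lemma AE_lebesgue_on_negligible:
  assumes "AE x in lebesgue_on S. P x" "S \<in> sets lebesgue"
  obtains E where "negligible E" "\<And>x. x \<in> S - E \<Longrightarrow> P x"
proof -
  have "AE x in lebesgue. x \<in> S \<longrightarrow> P x"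
    using assms by (subst (asm) AE_restrict_space_iff) auto
  then obtain E where "E \<in> null_sets lebesgue" "{x \<in> space lebesgue. \<not> (x \<in> S \<longrightarrow> P x)} \<subseteq> E"
    unfolding eventually_ae_filter by blast
  then show thesis
    by (intro that[of E]) (auto simp: negligible_iff_null_sets)
qed

text \<open>Only the order \<open>r - 1\<close> is absolutely continuous by definition. A lower
  order has a continuous derivative, bounded on the compact interval, and is therefore Lipschitz.
  Thus integration by parts can treat all orders alike.\<close>

lemma L2_diff_derivatives:
  assumes f: "f \<in> L2_diff r {-1..1}"
  shows "\<And>j. j < r \<Longrightarrow> abs_continuous_on {-1..1} (nderiv_on {-1..1} j f)"
    and "\<And>j. j < r \<Longrightarrow> continuous_on {-1..1} (nderiv_on {-1..1} j f)"
    and "\<And>j. j \<le> r \<Longrightarrow> nderiv_on {-1..1} j f \<in> L2"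
    and "\<And>j. j < r \<Longrightarrow> \<exists>E. negligible E \<and> (\<forall>x\<in>{-1..1} - E.
           (nderiv_on {-1..1} j f has_vector_derivative nderiv_on {-1..1} (Suc j) f x) (at x within {-1..1}))"
proof -
  let ?D = "\<lambda>j. nderiv_on {-1..1} j f"
  have der: "(?D j has_vector_derivative ?D (Suc j) x) (at x within {-1..1})"
    if "Suc j < r" "x \<in> {-1..1}" for j x
    using f that by (intro differentiable_imp_has_nderiv_on) (auto simp: L2_diff_def)
  have ac_top: "abs_continuous_on {-1..1} (?D (r - 1))"
    using f by (simp add: L2_diff_def)
  show cont: "continuous_on {-1..1} (?D j)" if "j < r" for j
  proof (cases "Suc j = r")
    case True
    then show ?thesis
      using ac_top
      by (auto intro!: uniformly_continuous_imp_continuous abs_continuous_on_imp_uniformly_continuous_on)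
  next
    case False
    then show ?thesis
      using that by (intro continuous_on_vector_derivative[of _ _ "?D (Suc j)"] der) auto
  qed
  show "abs_continuous_on {-1..1} (?D j)" if "j < r" for j
  proof (cases "Suc j = r")
    case True
    then show ?thesis using ac_top by auto
  next
    case False
    have "bounded (?D (Suc j) ` {-1..1})"
      using cont[of "Suc j"] that False by (intro compact_imp_bounded compact_continuous_image) auto
    then obtain B where "\<forall>y\<in>?D (Suc j) ` {-1..1}. norm y \<le> B"
      unfolding bounded_iff by blast
    then show ?thesis
      using that False
      by (intro Lipschitz_imp_abs_continuous_on[of _ _ B] bounded_derivative_imp_Lipschitz[OF _ der]) auto
  qed
  show "?D j \<in> L2" if "j \<le> r" for j
    using that f cont[of j] by (cases "j = r") (auto simp: L2_diff_def intro: L2_continuous_on)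
  show "\<exists>E. negligible E \<and> (\<forall>x\<in>{-1..1} - E.
           (?D j has_vector_derivative ?D (Suc j) x) (at x within {-1..1}))" if "j < r" for j
  proof (cases "Suc j = r")
    case True
    have "AE x in lebesgue_on {-1..1}. ?D (r - 1) differentiable (at x within {-1..1})"
      using f by (simp add: L2_diff_def)
    then obtain E where "negligible E" "\<And>x. x \<in> {-1..1} - E \<Longrightarrow> ?D (r - 1) differentiable (at x within {-1..1})"
      by (rule AE_lebesgue_on_negligible) auto
    then show ?thesis using True differentiable_imp_has_nderiv_on by (intro exI[of _ E]) auto
  next
    case False
    then show ?thesis using that der by (intro exI[of _ "{}"]) auto
  qed
qed

text \<open>\<open>G 0, \<dots>, G r\<close> are a function in \<open>L\<^sub>2\<^sup>r\<close> and its successive derivatives. Carrying them along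
  avoids computing \<open>nderiv_on\<close>, whose value is unspecified where a derivative does not exist.\<close>

definition L2_chain :: "nat \<Rightarrow> (nat \<Rightarrow> real \<Rightarrow> real) \<Rightarrow> bool" where
  "L2_chain r G \<longleftrightarrow>
     (\<forall>j<r - 1. \<forall>x\<in>{-1..1}. (G j has_vector_derivative G (Suc j) x) (at x within {-1..1})) \<and>
     abs_continuous_on {-1..1} (G (r - 1)) \<and>
     (\<exists>X. finite X \<and> (\<forall>x\<in>{-1..1} - X. (G (r - 1) has_vector_derivative G r x) (at x within {-1..1}))) \<and>
     G r \<in> L2"

lemma L2_chain_nderiv_on:
  assumes "L2_chain r G" "j < r" "x \<in> {-1..1}"
  shows "nderiv_on {-1..1} j (G 0) x = G j x"
  using assms(2,3)
proof (induction j arbitrary: x)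
  case (Suc j)
  have "(G j has_vector_derivative G (Suc j) x) (at x within {-1..1})"
    using assms(1) Suc.prems unfolding L2_chain_def by auto
  then have "(nderiv_on {-1..1} j (G 0) has_vector_derivative G (Suc j) x) (at x within {-1..1})"
    by (rule has_vector_derivative_transform[rotated 2]) (use Suc in auto)
  then show ?case
    using Suc.prems by (simp add: nderiv_on_Suc vector_derivative_within_closed_interval)
qed simp

text \<open>At order \<open>r\<close> agreement is claimed only off a finite set, since
  \<open>G (r - 1)\<close> may fail to be differentiable there and \<open>nderiv_on\<close> is then
  unspecified.\<close>

lemma L2_chain_nderiv_on_top:
  assumes "L2_chain r G" "r \<ge> 1"
  obtains X where "finite X"
    "\<And>x. x \<in> {-1..1} - X \<Longrightarrow> nderiv_on {-1..1} (r - 1) (G 0) differentiable (at x within {-1..1})"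
    "\<And>x. x \<in> {-1..1} - X \<Longrightarrow> nderiv_on {-1..1} r (G 0) x = G r x"
proof -
  obtain X where X: "finite X"
      "\<And>x. x \<in> {-1..1} - X \<Longrightarrow> (G (r - 1) has_vector_derivative G r x) (at x within {-1..1})"
    using assms(1) unfolding L2_chain_def by blast
  have *: "(nderiv_on {-1..1} (r - 1) (G 0) has_vector_derivative G r x) (at x within {-1..1})"
    if "x \<in> {-1..1} - X" for x
    using X(2)[OF that]
    by (rule has_vector_derivative_transform[rotated 2])
       (use that assms L2_chain_nderiv_on[OF assms(1), of "r - 1"] in auto)
  have "nderiv_on {-1..1} r (G 0) x = G r x" if x: "x \<in> {-1..1} - X" for x
    using vector_derivative_within_closed_interval[OF _ _ *[OF x]] x assms(2)
      nderiv_on_Suc[of "{-1..1}" "r - 1" "G 0" x] by simp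
  then show thesis
    using that[OF X(1)] * by (meson differentiableI_vector)
qed

lemma L2_chain_imp_L2_diff:
  assumes "L2_chain r G" "r \<ge> 1"
  shows "G 0 \<in> L2_diff r {-1..1}"
proof -
  obtain X where X: "finite X"
    "\<And>x. x \<in> {-1..1} - X \<Longrightarrow> nderiv_on {-1..1} (r - 1) (G 0) differentiable (at x within {-1..1})"
    "\<And>x. x \<in> {-1..1} - X \<Longrightarrow> nderiv_on {-1..1} r (G 0) x = G r x"
    using L2_chain_nderiv_on_top[OF assms] by blast
  have "nderiv_on {-1..1} j (G 0) differentiable (at x within {-1..1})"
    if "j < r - 1" "x \<in> {-1..1}" for j x
  proof -
    have "(G j has_vector_derivative G (Suc j) x) (at x within {-1..1})"
      using assms(1) that unfolding L2_chain_def by auto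
    then have "(nderiv_on {-1..1} j (G 0) has_vector_derivative G (Suc j) x) (at x within {-1..1})"
      by (rule has_vector_derivative_transform[rotated 2])
         (use that L2_chain_nderiv_on[OF assms(1), of j] in auto)
    then show ?thesis by (rule differentiableI_vector)
  qed
  moreover have "abs_continuous_on {-1..1} (nderiv_on {-1..1} (r - 1) (G 0))"
    by (rule abs_continuous_on_cong[of _ "G (r - 1)"])
       (use assms L2_chain_nderiv_on[OF assms(1), of "r - 1"] in \<open>auto simp: L2_chain_def\<close>)
  moreover have "AE x in lebesgue_on {-1..1}. nderiv_on {-1..1} (r - 1) (G 0) differentiable (at x within {-1..1})"
  proof (rule AE_I')
    show "X \<inter> {-1..1} \<in> null_sets (lebesgue_on {-1..1})"
      using X(1) by (auto simp: null_sets_restrict_space negligible_finite negligible_iff_null_sets[symmetric])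
  qed (use X(2) in auto)
  moreover have "nderiv_on {-1..1} r (G 0) \<in> L2"
    by (rule L2_on_finite_difference[of "G r" _ X]) (use assms X in \<open>auto simp: L2_chain_def\<close>)
  ultimately show ?thesis by (auto simp: L2_diff_def)
qed

lemma L2_chain_norm_top:
  assumes "L2_chain r G" "r \<ge> 1"
  shows "L2_norm (nderiv_on {-1..1} r (G 0)) = L2_norm (G r)"
proof -
  obtain X where "finite X" "\<And>x. x \<in> {-1..1} - X \<Longrightarrow> nderiv_on {-1..1} r (G 0) x = G r x"
    using L2_chain_nderiv_on_top[OF assms] by metis
  then show ?thesis by (rule L2_norm_finite_difference)
qed

lemma L2_chain_integral_top:
  assumes "L2_chain r G" "r \<ge> 1"
  shows "(LINT x|lebesgue_on {-1..1}. u x * nderiv_on {-1..1} r (G 0) x) =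
         (LINT x|lebesgue_on {-1..1}. u x * G r x)"
proof -
  obtain X where "finite X" "\<And>x. x \<in> {-1..1} - X \<Longrightarrow> nderiv_on {-1..1} r (G 0) x = G r x"
    using L2_chain_nderiv_on_top[OF assms] by metis
  then show ?thesis
    by (intro lebesgue_on_integral_finite_difference[of _ X]) auto
qed

lemma L2_chain_cmult:
  assumes "L2_chain r G"
  shows "L2_chain r (\<lambda>j x. c * G j x)"
proof -
  have "abs_continuous_on {-1..1} (G (r - 1))" using assms by (simp add: L2_chain_def)
  then have "abs_continuous_on {-1..1} (\<lambda>x. c * G (r - 1) x)"
    by (rule abs_continuous_on_dominated[where B = "\<bar>c\<bar>", OF _ abs_continuous_on_ident])
       (simp add: right_diff_distrib[symmetric] abs_mult mult_left_mono)
  then show ?thesis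
    using assms unfolding L2_chain_def
    by (auto intro!: has_vector_derivative_mult_right L2_on_cmult)
qed

lemma L2_chain_scaled_W2:
  assumes "L2_chain r G" "r \<ge> 1" "\<bar>c\<bar> * L2_norm (G r) \<le> 1"
  shows "(\<lambda>x. c * G 0 x) \<in> W2 r"
proof -
  have G': "L2_chain r (\<lambda>j x. c * G j x)" by (rule L2_chain_cmult[OF assms(1)])
  show ?thesis
    using L2_chain_imp_L2_diff[OF G' assms(2)] L2_chain_norm_top[OF G' assms(2)] assms(3)
    by (simp add: W2_def L2_norm_cmult)
qed

lemma L2_chain_scaled_nderiv_on:
  assumes "L2_chain r G" "j < r" "x \<in> {-1..1}"
  shows "nderiv_on {-1..1} j (\<lambda>x. c * G 0 x) x = c * G j x"
  using L2_chain_nderiv_on[OF L2_chain_cmult[OF assms(1)] assms(2,3)] .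

section \<open>Infinite error, and the case of \<open>N\<close> below the sharp constant\<close>

lemma U_err_eq_infinity:
  assumes G: "L2_chain r G" and r: "r \<ge> 1" "k < r" "t \<in> {-1..1}"
    and 0: "L2_norm (G r) = 0" and S: "bounded_functional S" and ne: "S (G 0) \<noteq> G k t"
  shows "U_err r k t S = \<infinity>"
proof (rule ereal_top)
  fix B :: real
  have GL2: "G 0 \<in> L2"
    using L2_diff_derivatives(3)[OF L2_chain_imp_L2_diff[OF G r(1)], of 0] by simp
  define \<delta> where "\<delta> = \<bar>G k t - S (G 0)\<bar>"
  have \<delta>: "\<delta> > 0" using ne by (simp add: \<delta>_def)
  \<comment> \<open>Since the derivative of order \<open>r\<close> has norm 0, every multiple of
    \<open>G 0\<close> stays in \<open>W2 r\<close>. The error scales linearly, and this factor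
    raises it to \<open>\<bar>B\<bar> + 1\<close>.\<close>
  define c where "c = (\<bar>B\<bar> + 1) / \<delta>"
  have c: "c \<ge> 0" using \<delta> by (simp add: c_def)
  have W: "(\<lambda>x. c * G 0 x) \<in> W2 r"
    by (rule L2_chain_scaled_W2[OF G r(1)]) (simp add: 0)
  have "S (\<lambda>x. c * G 0 x) = c * S (G 0)"
    using S GL2 by (simp add: bounded_functional_def)
  then have "\<bar>nderiv_on {-1..1} k (\<lambda>x. c * G 0 x) t - S (\<lambda>x. c * G 0 x)\<bar> = c * \<delta>"
    using L2_chain_scaled_nderiv_on[OF G r(2,3)] c
    by (simp add: \<delta>_def abs_mult flip: right_diff_distrib)
  also have "\<dots> = \<bar>B\<bar> + 1" using \<delta> by (simp add: c_def)
  finally have "ereal B \<le> ereal \<bar>nderiv_on {-1..1} k (\<lambda>x. c * G 0 x) t - S (\<lambda>x. c * G 0 x)\<bar>"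
    by simp
  also have "\<dots> \<le> U_err r k t S"
    unfolding U_err_def by (rule SUP_upper[OF W])
  finally show "ereal B \<le> U_err r k t S" .
qed

lemma higher_pderiv_degree_less:
  fixes Q :: "real poly"
  shows "degree Q < n \<Longrightarrow> (pderiv ^^ n) Q = 0"
proof (induction n arbitrary: Q)
  case (Suc n)
  show ?case
  proof (cases "degree Q = 0")
    case True
    then have "pderiv Q = 0" by (simp add: pderiv_eq_0_iff)
    moreover have "(pderiv ^^ n) (0 :: real poly) = 0" by (induction n) auto
    ultimately show ?thesis by (simp add: funpow_Suc_right del: funpow.simps)
  next
    case False
    then have "degree (pderiv Q) < n" using Suc.prems by (simp add: degree_pderiv)
    then show ?thesis using Suc.IH by (simp add: funpow_Suc_right del: funpow.simps)
  qed
qed simp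

lemma L2_chain_poly:
  assumes "r \<ge> 1"
  shows "L2_chain r (\<lambda>j. poly ((pderiv ^^ j) Q))"
proof -
  have der: "(poly ((pderiv ^^ j) Q) has_vector_derivative poly ((pderiv ^^ Suc j) Q) x) (at x within S)" for j x S
    using poly_DERIV[of "(pderiv ^^ j) Q" x]
    by (auto simp: has_real_derivative_iff_has_vector_derivative intro: has_vector_derivative_at_within)
  have cont: "continuous_on {-1..1} (poly P)" for P :: "real poly"
    by (intro continuous_intros)
  have "bounded (poly ((pderiv ^^ r) Q) ` {-1..1})"
    by (intro compact_imp_bounded compact_continuous_image cont) auto
  then obtain B where "\<forall>y\<in>poly ((pderiv ^^ r) Q) ` {-1..1}. norm y \<le> B"
    unfolding bounded_iff by blast
  then have "abs_continuous_on {-1..1} (poly ((pderiv ^^ (r - 1)) Q))"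
    using der[of "r - 1"] assms
    by (intro Lipschitz_imp_abs_continuous_on[of _ _ B]
          bounded_derivative_imp_Lipschitz[of "{-1..1}" _ "poly ((pderiv ^^ r) Q)"]) auto
  then show ?thesis
    unfolding L2_chain_def using der[of "r - 1"] der assms
    by (auto intro!: L2_continuous_on cont exI[of _ "{}"])
qed

text \<open>Below the infimum \<open>N\<close> is not an admissible constant, so some polynomial
  \<open>Q\<close> violates the inequality. A functional of norm at most \<open>N\<close> is then
  too small at \<open>Q\<close> to reproduce its derivative at \<open>t\<close>.\<close>

lemma E_err_below_sharp_const:
  assumes "r \<ge> 1" "k \<le> r - 1" "t \<in> {-1<..<1}" "N < sharp_const r k t"
  shows "E_err r k t N = \<infinity>"
proof -
  let ?A = "{M. \<forall>Q :: real poly. degree Q \<le> r - 1 \<longrightarrow>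
               \<bar>poly ((pderiv ^^ k) Q) t\<bar> \<le> M * L2_norm (poly Q)}"
  \<comment> \<open>The constant polynomial has positive norm, which forces admissible constants to
    be nonnegative; hence the real \<open>Inf\<close> is a lower bound.\<close>
  have "L2_norm (poly 1) = sqrt 2"
    by (simp add: L2_norm_def measure_restrict_space)
  then have "0 \<le> M" if "M \<in> ?A" for M
    using that order_trans[OF abs_ge_zero, of "poly ((pderiv ^^ k) 1) t" "M * sqrt 2"]
    by (auto simp: zero_le_mult_iff dest: spec[of _ 1])
  then have bdd: "bdd_below ?A" by (rule bdd_belowI)
  then have "N \<notin> ?A"
    using assms(4) cInf_lower[OF _ bdd, of N] unfolding sharp_const_def by linarith
  then obtain Q :: "real poly" where Q: "degree Q \<le> r - 1"
      "N * L2_norm (poly Q) < \<bar>poly ((pderiv ^^ k) Q) t\<bar>"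
    by (auto simp: not_le)
  let ?G = "\<lambda>j. poly ((pderiv ^^ j) Q)"
  have G: "L2_chain r ?G" by (rule L2_chain_poly[OF assms(1)])
  have "U_err r k t S = \<infinity>" if S: "bounded_functional S" "functional_norm S \<le> N" for S
  proof (rule U_err_eq_infinity[OF G assms(1) _ _ _ S(1)])
    show "L2_norm (?G r) = 0"
      using higher_pderiv_degree_less[of Q r] Q(1) assms(1) by (simp add: L2_norm_def)
    have "poly Q \<in> L2"
      by (rule L2_continuous_on) (intro continuous_intros)
    then have "\<bar>S (poly Q)\<bar> \<le> functional_norm S * L2_norm (poly Q)"
      by (rule functional_norm_bound[OF S(1)])
    also have "\<dots> \<le> N * L2_norm (poly Q)"
      by (rule mult_right_mono[OF S(2) L2_norm_nonneg])
    finally show "S (?G 0) \<noteq> ?G k t" using Q(2) by auto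
  qed (use assms in auto)
  then show ?thesis
    \<comment> \<open>This also covers an empty class of functionals, over which the infimum is
      infinite.\<close>
    unfolding E_err_def by (intro INF_eqI) (auto simp: top_ereal_def)
qed

section \<open>Functions with a prescribed derivative of order \<open>r\<close>\<close>

lemma minus_one_power_cancel: "(-1 :: real) ^ n * ((-1) ^ n * y) = y"
  by (simp add: minus_one_power_iff)

text \<open>The function is found by integrating \<open>h\<close> repeatedly, with the constants of
  integration fixed by the values \<open>v j\<close> at \<open>t\<close>. Boundedness of
  \<open>h\<close> makes the first primitive Lipschitz, and continuity off \<open>X\<close> makes it
  differentiable there.\<close>

lemma L2_chain_exists:
  fixes h :: "real \<Rightarrow> real"
  assumes r: "r \<ge> 1" and t: "t \<in> {-1..1}" and h: "h \<in> L2" and B: "\<And>x. x \<in> {-1..1} \<Longrightarrow> \<bar>h x\<bar> \<le> B"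
    and X: "finite X" and cont: "\<And>x. x \<in> {-1..1} - X \<Longrightarrow> continuous (at x within {-1..1}) h"
  obtains G where "L2_chain r G" "G r = h" "\<And>j. j < r \<Longrightarrow> G j t = v j"
    "\<And>j a b. j < r \<Longrightarrow> -1 \<le> a \<Longrightarrow> a \<le> b \<Longrightarrow> b \<le> 1 \<Longrightarrow> G j b - G j a = integral {a..b} (G (Suc j))"
proof -
  \<comment> \<open>\<open>P i\<close> is the derivative of order \<open>r - i\<close>. The
    difference of two integrals from -1 stands for an integral from \<open>t\<close> to
    \<open>x\<close>, on either side of \<open>t\<close>.\<close>
  define P where "P = rec_nat h (\<lambda>i g x. v (r - Suc i) + (integral {-1..x} g - integral {-1..t} g))"
  have P0: "P 0 = h" by (simp add: P_def)
  have PS: "P (Suc i) x = v (r - Suc i) + (integral {-1..x} (P i) - integral {-1..t} (P i))" for i x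
    by (simp add: P_def)
  interpret finite_measure "lebesgue_on {-1..1::real}" by (rule finite_measure_lebesgue_on) auto
  have "integrable (lebesgue_on {-1..1}) h"
    by (rule integrable_const_bound[where B = B]) (use h B in \<open>auto simp: L2_on_def\<close>)
  then have hint: "h integrable_on {-1..1}"
    by (rule integrable_on_lebesgue_on) auto
  have PSc: "continuous_on {-1..1} (P (Suc i))" if "P i integrable_on {-1..1}" for i
    unfolding PS[abs_def] by (intro continuous_intros indefinite_integral_continuous_1 that)
  have Pint: "P i integrable_on {-1..1}" for i
    by (induction i) (auto simp: P0 hint intro: integrable_continuous_real PSc)
  have Pc: "continuous_on {-1..1} (P (Suc i))" for i by (rule PSc[OF Pint])
  have diff: "P (Suc i) b - P (Suc i) a = integral {a..b} (P i)" if "-1 \<le> a" "a \<le> b" "b \<le> 1" for i a b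
  proof -
    have "P i integrable_on {-1..b}"
      by (rule integrable_subinterval_real[OF Pint]) (use that in auto)
    from Henstock_Kurzweil_Integration.integral_combine[OF that(1,2) this]
    show ?thesis by (simp add: PS)
  qed
  have der: "(P (Suc i) has_vector_derivative P i x) (at x within {-1..1})"
    if "x \<in> {-1..1}" "continuous (at x within {-1..1}) (P i)" for i x
  proof -
    have "((\<lambda>u. integral {-1..u} (P i)) has_vector_derivative P i x) (at x within {-1..1})"
      using integral_has_vector_derivative_continuous_at[OF Pint, of x "{}"] that by simp
    then have "((\<lambda>u. v (r - Suc i) + (integral {-1..u} (P i) - integral {-1..t} (P i)))
        has_vector_derivative 0 + (P i x - 0)) (at x within {-1..1})"
      by (intro has_vector_derivative_add has_vector_derivative_diff has_vector_derivative_const)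
    then show ?thesis by (simp add: PS[abs_def])
  qed
  have Lip: "abs_continuous_on {-1..1} (P (Suc 0))"
  proof (rule Lipschitz_imp_abs_continuous_on[where B = B])
    have *: "\<bar>P (Suc 0) b - P (Suc 0) a\<bar> \<le> B * \<bar>b - a\<bar>" if ab: "-1 \<le> a" "a \<le> b" "b \<le> 1" for a b
    proof -
      have "h integrable_on {a..b}"
        by (rule integrable_subinterval_real[OF hint]) (use ab in auto)
      then have "norm (integral {a..b} h) \<le> integral {a..b} (\<lambda>_. B)"
        by (rule integral_norm_bound_integral) (use B ab in auto)
      then show ?thesis using diff[OF ab, of 0] ab by (simp add: P0 mult.commute)
    qed
    fix a b :: real assume "a \<in> {-1..1}" "b \<in> {-1..1}"
    then show "\<bar>P (Suc 0) b - P (Suc 0) a\<bar> \<le> B * \<bar>b - a\<bar>"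
      using *[of a b] *[of b a] by (cases "a \<le> b") (auto simp: abs_minus_commute)
  qed
  define G where "G j = P (r - j)" for j
  have GS: "G j = P (Suc (r - Suc j))" "G (Suc j) = P (r - Suc j)" if "j < r" for j
    using that by (auto simp: G_def Suc_diff_Suc)
  show thesis
  proof (rule that)
    show "G r = h" by (simp add: G_def P0)
    show "G j t = v j" if "j < r" for j
      using that by (simp add: GS(1) PS)
    show "G j b - G j a = integral {a..b} (G (Suc j))" if "j < r" "-1 \<le> a" "a \<le> b" "b \<le> 1" for j a b
      using diff[OF that(2-4)] that(1) by (simp add: GS)
    show "L2_chain r G"
      unfolding L2_chain_def
    proof (intro conjI allI impI ballI)
      fix j x assume j: "j < r - 1" and x: "x \<in> {-1..1::real}"
      \<comment> \<open>Below the order \<open>r - 1\<close> the integrand is itself a primitive,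
        hence continuous everywhere, so no exceptional points arise.\<close>
      then have "r - Suc j = Suc (r - Suc (Suc j))" "j < r" by auto
      then show "(G j has_vector_derivative G (Suc j) x) (at x within {-1..1})"
        using der[OF x] Pc x by (simp add: GS continuous_on_eq_continuous_within)
    next
      show "abs_continuous_on {-1..1} (G (r - 1))"
        using Lip r by (simp add: G_def)
      show "\<exists>X. finite X \<and> (\<forall>x\<in>{-1..1} - X. (G (r - 1) has_vector_derivative G r x) (at x within {-1..1}))"
        using X cont der[of _ 0] r by (intro exI[of _ X]) (auto simp: G_def P0)
      show "G r \<in> L2" using h by (simp add: G_def P0)
    qed
  qed
qed

section \<open>The boundary value problem\<close>

locale bvp_solution =
  fixes r k :: nat and lam t :: real and u :: "real \<Rightarrow> real"
  assumes r: "r \<ge> 1" and k: "k < r" and t: "-1 < t" "t < 1" and lam: "lam \<ge> 0"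
    and is_u: "is_u r k lam t u"
begin

abbreviation "\<Omega> \<equiv> {-1<..<t} \<union> {t<..<1}"

abbreviation "pieces \<equiv> {{-1<..<t}, {t<..<1}}"

abbreviation "D s \<equiv> pderivs t s u"

section \<open>Regularity and one-sided limits of the derivatives of \<open>u\<close>\<close>

lemma finite_outside: "finite ({-1..1} - \<Omega>)"
proof (rule finite_subset)
  show "{-1..1} - \<Omega> \<subseteq> {-1, t, 1}" by auto
qed simp

lemma piece_eq:
  assumes "S \<in> pieces" "x \<in> S"
  shows "nderiv_on S s u x = D s x" "at x within S = at x"
proof -
  have S: "open S" "open \<Omega>" "S \<subseteq> \<Omega>" using assms(1) by auto
  show "nderiv_on S s u x = D s x" by (rule nderiv_on_open_subset[OF S assms(2)])
  show "at x within S = at x" by (rule at_within_open[OF assms(2) S(1)])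
qed

lemma u_L2_diff: "S \<in> pieces \<Longrightarrow> u \<in> L2_diff (2 * r) S"
  using is_u by (auto simp: is_u_def)

lemma piece_deriv:
  assumes S: "S \<in> pieces" and x: "x \<in> S" and diff: "nderiv_on S s u differentiable (at x within S)"
  shows "(D s has_vector_derivative D (Suc s) x) (at x)"
proof -
  have "(nderiv_on S s u has_vector_derivative D (Suc s) x) (at x)"
    using differentiable_imp_has_nderiv_on[OF diff] piece_eq[OF S x] by simp
  then show ?thesis
    by (rule has_vector_derivative_transform_within_open[where S = S]) (use S x piece_eq in auto)
qed

lemma D_deriv:
  assumes "s < 2 * r - 1" "x \<in> \<Omega>"
  shows "(D s has_vector_derivative D (Suc s) x) (at x)"
proof -
  obtain S where S: "S \<in> pieces" "x \<in> S" using assms(2) by blast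
  then show ?thesis
    using u_L2_diff[OF S(1)] assms(1) by (intro piece_deriv[OF S]) (auto simp: L2_diff_def)
qed

lemma D_deriv_ae:
  assumes "s < 2 * r"
  obtains E where "negligible E" "\<And>x. x \<in> \<Omega> - E \<Longrightarrow> (D s has_vector_derivative D (Suc s) x) (at x)"
proof (cases "s = 2 * r - 1")
  case True
  have "\<exists>E. negligible E \<and> (\<forall>x\<in>S - E. (D s has_vector_derivative D (Suc s) x) (at x))"
    if S: "S \<in> pieces" for S
  proof -
    have "AE x in lebesgue_on S. nderiv_on S s u differentiable (at x within S)"
      using u_L2_diff[OF S] True by (simp add: L2_diff_def)
    then obtain E where "negligible E" "\<And>x. x \<in> S - E \<Longrightarrow> nderiv_on S s u differentiable (at x within S)"
      by (rule AE_lebesgue_on_negligible) (use S in auto)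
    then show ?thesis using piece_deriv[OF S] by (intro exI[of _ E]) auto
  qed
  then obtain E1 E2 where "negligible E1" "negligible E2"
      "\<forall>x\<in>{-1<..<t} - E1. (D s has_vector_derivative D (Suc s) x) (at x)"
      "\<forall>x\<in>{t<..<1} - E2. (D s has_vector_derivative D (Suc s) x) (at x)"
    by (meson insertI1 insertI2)
  then show ?thesis by (intro that[of "E1 \<union> E2"]) (auto intro: negligible_Un)
next
  case False
  then show ?thesis using D_deriv assms by (intro that[of "{}"]) auto
qed

text \<open>Downward induction from the order \<open>2 * r - 1\<close>, where the claim is part of
  the definition. The pieces are not compact, so the bound on the next derivative comes from its
  uniform continuity on a bounded interval; it makes the present one Lipschitz.\<close>

lemma D_abs_continuous:
  assumes "s < 2 * r" "S \<in> pieces"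
  shows "abs_continuous_on S (D s)"
  using assms(1)
proof (induction "2 * r - 1 - s" arbitrary: s)
  case 0
  then have "s = 2 * r - 1" by simp
  then have "abs_continuous_on S (nderiv_on S s u)"
    using u_L2_diff[OF assms(2)] by (simp add: L2_diff_def)
  then show ?case by (rule abs_continuous_on_cong) (simp add: piece_eq[OF assms(2)])
next
  case (Suc n)
  have S: "is_interval S" "bounded S" "S \<subseteq> \<Omega>" "convex S"
    using assms(2) bounded_subset[OF bounded_closed_interval[of "-1" "1::real"], of S] t
    by auto
  have "abs_continuous_on S (D (Suc s))" using Suc by (intro Suc.hyps(1)) auto
  then have "bounded (D (Suc s) ` S)"
    using S by (intro bounded_uniformly_continuous_image abs_continuous_on_imp_uniformly_continuous_on)
  then obtain B where "\<forall>y\<in>D (Suc s) ` S. norm y \<le> B" unfolding bounded_iff by blast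
  then have B: "\<And>x. x \<in> S \<Longrightarrow> \<bar>D (Suc s) x\<bar> \<le> B" by auto
  have der: "(D s has_vector_derivative D (Suc s) x) (at x within S)" if "x \<in> S" for x
  proof -
    have "s < 2 * r - 1" "x \<in> \<Omega>" using Suc.hyps(2) S(3) that by auto
    then show ?thesis by (rule has_vector_derivative_at_within[OF D_deriv])
  qed
  show ?case
    by (rule Lipschitz_imp_abs_continuous_on, rule bounded_derivative_imp_Lipschitz[OF S(4) der B])
qed

lemma D_continuous:
  assumes "s < 2 * r" "S \<in> pieces"
  shows "continuous_on S (D s)"
  by (rule uniformly_continuous_imp_continuous, rule abs_continuous_on_imp_uniformly_continuous_on)
     (use D_abs_continuous[OF assms] assms(2) in auto)

lemma D_continuous_\<Omega>: "s < 2 * r \<Longrightarrow> continuous_on \<Omega> (D s)"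
  by (intro continuous_on_open_Un D_continuous) auto

lemma D_bounded:
  assumes "s < 2 * r"
  obtains B where "\<And>x. x \<in> \<Omega> \<Longrightarrow> \<bar>D s x\<bar> \<le> B"
proof -
  have "bounded (D s ` S)" if S: "S \<in> pieces" for S
  proof (rule bounded_uniformly_continuous_image)
    show "uniformly_continuous_on S (D s)"
      by (rule abs_continuous_on_imp_uniformly_continuous_on[OF D_abs_continuous[OF assms S]])
         (use S in auto)
    show "bounded S"
      using S t bounded_subset[OF bounded_closed_interval[of "-1" "1::real"], of S] by auto
  qed
  then have "bounded (D s ` {-1<..<t} \<union> D s ` {t<..<1})" by simp
  then obtain B where "\<forall>y\<in>D s ` {-1<..<t} \<union> D s ` {t<..<1}. norm y \<le> B"
    unfolding bounded_iff by blast
  then show thesis by (intro that[of B]) auto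
qed

text \<open>The values of \<open>D s\<close> at the points -1, \<open>t\<close> and 1 are not
  controlled. Replacing them by 0 gives a bounded Borel function.\<close>

lemma restricted_L2:
  assumes "s < 2 * r"
  shows "(\<lambda>x. if x \<in> \<Omega> then D s x else 0) \<in> L2"
proof -
  obtain B where B: "\<And>x. x \<in> \<Omega> \<Longrightarrow> \<bar>D s x\<bar> \<le> B" by (rule D_bounded[OF assms]) (rule that)
  have "(\<lambda>x. indicator \<Omega> x *\<^sub>R D s x) \<in> borel_measurable borel"
    by (rule borel_measurable_continuous_on_indicator[OF _ D_continuous_\<Omega>[OF assms]]) auto
  then have "(\<lambda>x. if x \<in> \<Omega> then D s x else 0) \<in> borel_measurable borel"
    by (rule measurable_cong[THEN iffD1, rotated]) (auto simp: indicator_def)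
  then have "(\<lambda>x. if x \<in> \<Omega> then D s x else 0) \<in> borel_measurable (lebesgue_on {-1..1})"
    by (intro measurable_restrict_space1 measurable_completion) simp
  then show ?thesis
    by (rule L2_on_bounded[where B = "\<bar>B\<bar>"]) (use B in force)+
qed

lemma D_L2: "s < 2 * r \<Longrightarrow> D s \<in> L2"
  by (rule L2_on_finite_difference[OF restricted_L2 _ finite_outside]) auto

lemma u_L2: "u \<in> L2"
  using D_L2[of 0] r by simp

lemma D_top: "x \<in> \<Omega> \<Longrightarrow> D (2 * r) x = - ((-1) ^ r * lam) * u x"
proof -
  assume "x \<in> \<Omega>"
  then have "(-1) ^ r * D (2 * r) x = - (lam * u x)"
    using is_u unfolding is_u_def by (simp add: eq_neg_iff_add_eq_0)
  then have "(-1) ^ r * ((-1) ^ r * D (2 * r) x) = - ((-1) ^ r * lam) * u x" by simp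
  then show ?thesis by (simp only: minus_one_power_cancel)
qed

lemma D_limits_ends:
  "s < r \<Longrightarrow> (D s \<longlongrightarrow> 0) (at_right (-1))" "s < r \<Longrightarrow> (D s \<longlongrightarrow> 0) (at_left 1)"
  using is_u by (auto simp: is_u_def)

lemma D_jump:
  assumes "s < 2 * r"
  obtains p q where "(D s \<longlongrightarrow> p) (at_right t)" "(D s \<longlongrightarrow> q) (at_left t)"
    "p - q = (if s = r - Suc k then - ((-1) ^ k) else 0)"
proof -
  \<comment> \<open>The integer exponent becomes a natural one at the price of a sign, so that
    \<open>k = 0\<close> needs no separate treatment later.\<close>
  have "(-1 :: real) powi (int k - 1) = - ((-1) ^ k)"
    by (simp add: power_int_diff)
  moreover have "int s = int r - int k - 1 \<longleftrightarrow> s = r - Suc k" using k by auto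
  ultimately show thesis
    using is_u assms that unfolding is_u_def by auto
qed

section \<open>The error identity by repeated integration by parts\<close>

lemma integration_by_parts_jump:
  assumes f: "f \<in> L2_diff r {-1..1}" and j: "j < r"
  shows "(LINT x|lebesgue_on {-1..1}. D (r - j) x * nderiv_on {-1..1} j f x) +
         (LINT x|lebesgue_on {-1..1}. D (r - Suc j) x * nderiv_on {-1..1} (Suc j) f x) =
         (if j = k then (-1) ^ k * nderiv_on {-1..1} k f t else 0)"
proof -
  let ?f = "\<lambda>j. nderiv_on {-1..1} j f"
  define s where "s = r - Suc j"
  have s: "s < r" "Suc s = r - j" "s < 2 * r - 1" "s < 2 * r" "Suc s < 2 * r" using j by (auto simp: s_def)
  define h where "h = (\<lambda>x. D (Suc s) x * ?f j x + D s x * ?f (Suc j) x)"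
  have int1: "integrable (lebesgue_on {-1..1}) (\<lambda>x. D (Suc s) x * ?f j x)"
    using j by (intro L2_on_mult_integrable D_L2 s L2_diff_derivatives(3)[OF f]) auto
  have int2: "integrable (lebesgue_on {-1..1}) (\<lambda>x. D s x * ?f (Suc j) x)"
    using j by (intro L2_on_mult_integrable D_L2 s L2_diff_derivatives(3)[OF f]) auto
  have hint: "integrable (lebesgue_on {-1..1}) h"
    unfolding h_def by (intro Bochner_Integration.integrable_add int1 int2)
  then have h_on: "h integrable_on {-1..1}" by (rule integrable_on_lebesgue_on) auto
  obtain E where E: "negligible E"
      "\<And>x. x \<in> {-1..1} - E \<Longrightarrow> (?f j has_vector_derivative ?f (Suc j) x) (at x within {-1..1})"
    using L2_diff_derivatives(4)[OF f j] by blast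
  have dq: "(?f j has_vector_derivative ?f (Suc j) x) (at x)" if "x \<in> {-1<..<1} - E" for x
    using E(2)[of x] that by (auto simp: at_within_Icc_at)
  have cont: "continuous_on {-1..1} (?f j)" by (rule L2_diff_derivatives(2)[OF f j])
  have lim_t: "(?f j \<longlongrightarrow> ?f j t) (at t)"
    using cont t at_within_Icc_at[of "-1" t 1] by (auto simp: continuous_on_def dest: bspec[of _ _ t])
  have lim_l: "(?f j \<longlongrightarrow> ?f j (-1)) (at_right (-1))"
    using cont at_within_Icc_at_right[of "-1" "1::real"] by (auto simp: continuous_on_def dest: bspec[of _ _ "-1"])
  have lim_r: "(?f j \<longlongrightarrow> ?f j 1) (at_left 1)"
    using cont at_within_Icc_at_left[of "-1" "1::real"] by (auto simp: continuous_on_def dest: bspec[of _ _ "1"])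
  obtain p q where pq: "(D s \<longlongrightarrow> p) (at_right t)" "(D s \<longlongrightarrow> q) (at_left t)"
      "p - q = (if s = r - Suc k then - ((-1) ^ k) else 0)"
    by (rule D_jump[OF s(4)])
  have ac: "abs_continuous_on {a<..<b} (?f j)" if "-1 \<le> a" "b \<le> 1" for a b
    by (rule abs_continuous_on_subset[OF L2_diff_derivatives(1)[OF f j]]) (use that in auto)
  \<comment> \<open>The outer boundary terms vanish because \<open>s < r\<close>. The left piece
    leaves \<open>q\<close> and the right piece \<open>- p\<close> times the value of the continuous
    factor at \<open>t\<close>, so only the jump of \<open>D s\<close> survives.\<close>
  have "integral {-1..t} h = q * ?f j t - 0 * ?f j (-1)"
    unfolding h_def
  proof (rule integration_by_parts_abs_continuous[OF t(1) D_abs_continuous[OF s(4)] ac E(1)])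
    show "(D s has_vector_derivative D (Suc s) x) (at x)" if "x \<in> {-1<..<t} - E" for x
      by (rule D_deriv[OF s(3)]) (use that in auto)
    show "(?f j has_vector_derivative ?f (Suc j) x) (at x)" if "x \<in> {-1<..<t} - E" for x
      by (rule dq) (use that t in auto)
    show "(\<lambda>x. D (Suc s) x * ?f j x + D s x * ?f (Suc j) x) integrable_on {-1..t}"
      by (rule integrable_subinterval_real[OF h_on[unfolded h_def]]) (use t in auto)
    show "((\<lambda>x. D s x * ?f j x) \<longlongrightarrow> 0 * ?f j (-1)) (at_right (-1))"
      by (intro tendsto_mult D_limits_ends s lim_l)
    show "((\<lambda>x. D s x * ?f j x) \<longlongrightarrow> q * ?f j t) (at_left t)"
      by (intro tendsto_mult pq tendsto_within_subset[OF lim_t]) auto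
  qed (use t in auto)
  moreover have "integral {t..1} h = 0 * ?f j 1 - p * ?f j t"
    unfolding h_def
  proof (rule integration_by_parts_abs_continuous[OF t(2) D_abs_continuous[OF s(4)] ac E(1)])
    show "(D s has_vector_derivative D (Suc s) x) (at x)" if "x \<in> {t<..<1} - E" for x
      by (rule D_deriv[OF s(3)]) (use that in auto)
    show "(?f j has_vector_derivative ?f (Suc j) x) (at x)" if "x \<in> {t<..<1} - E" for x
      by (rule dq) (use that t in auto)
    show "(\<lambda>x. D (Suc s) x * ?f j x + D s x * ?f (Suc j) x) integrable_on {t..1}"
      by (rule integrable_subinterval_real[OF h_on[unfolded h_def]]) (use t in auto)
    show "((\<lambda>x. D s x * ?f j x) \<longlongrightarrow> 0 * ?f j 1) (at_left 1)"
      by (intro tendsto_mult D_limits_ends s lim_r)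
    show "((\<lambda>x. D s x * ?f j x) \<longlongrightarrow> p * ?f j t) (at_right t)"
      by (intro tendsto_mult pq tendsto_within_subset[OF lim_t]) auto
  qed (use t in auto)
  moreover have "integral {-1..t} h + integral {t..1} h = integral {-1..1} h"
    by (rule Henstock_Kurzweil_Integration.integral_combine[OF _ _ h_on]) (use t in auto)
  ultimately have "integral {-1..1} h = - (p - q) * ?f j t" by (simp add: algebra_simps)
  also have "\<dots> = (if j = k then (-1) ^ k * ?f k t else 0)"
  proof -
    have "s = r - Suc k \<longleftrightarrow> j = k" using j k by (auto simp: s_def)
    then show ?thesis using pq(3) by auto
  qed
  finally have "(LINT x|lebesgue_on {-1..1}. h x) = (if j = k then (-1) ^ k * ?f k t else 0)"
    using lebesgue_integral_eq_integral[OF hint] by simp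
  moreover have "(LINT x|lebesgue_on {-1..1}. h x) =
      (LINT x|lebesgue_on {-1..1}. D (Suc s) x * ?f j x) + (LINT x|lebesgue_on {-1..1}. D s x * ?f (Suc j) x)"
    unfolding h_def by (rule Bochner_Integration.integral_add[OF int1 int2])
  ultimately show ?thesis using s(2) by (simp add: s_def)
qed

text \<open>With \<open>T j\<close> as below, \<open>T 0\<close> is \<open>S_opt\<close> and
  \<open>T r\<close> is the error integral. Consecutive terms are opposite except at
  \<open>j = k\<close>, where the jump enters.\<close>

theorem representation:
  assumes f: "f \<in> L2_diff r {-1..1}"
  shows "nderiv_on {-1..1} k f t - S_opt r t u f =
         - ((-1) ^ r) * (LINT x|lebesgue_on {-1..1}. u x * nderiv_on {-1..1} r f x)"
proof -
  define T where "T j = (LINT x|lebesgue_on {-1..1}. D (r - j) x * nderiv_on {-1..1} j f x)" for j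
  have step: "T j = (if j = k then (-1) ^ k * nderiv_on {-1..1} k f t else 0) - T (Suc j)" if "j < r" for j
    using integration_by_parts_jump[OF f that] by (simp add: T_def)
  \<comment> \<open>The jump is met once, after \<open>k\<close> changes of sign, which cancel its
    factor \<open>(-1) ^ k\<close>.\<close>
  have "T 0 = (-1) ^ n * T n + (if k < n then nderiv_on {-1..1} k f t else 0)" if "n \<le> r" for n
    using that
  proof (induction n)
    case (Suc n)
    show ?case
      using Suc step[of n] by (cases "n = k") (auto simp: right_diff_distrib minus_one_power_cancel)
  qed simp
  from this[of r] show ?thesis using k by (simp add: T_def S_opt_def)
qed

lemma W2_imp_L2: "f \<in> W2 r \<Longrightarrow> f \<in> L2"
  using L2_diff_derivatives(3)[of f r 0] by (simp add: W2_def)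

text \<open>Two multiples of \<open>u\<close> are needed as top derivatives: the normalised one, at
  which Cauchy-Schwarz is sharp, and the one that the differential equation assigns to the order
  \<open>2 * r\<close>.\<close>

lemma restricted_u_chain:
  obtains G where "L2_chain r G" "G r = (\<lambda>x. if x \<in> \<Omega> then c * u x else 0)" "\<And>j. j < r \<Longrightarrow> G j t = v j"
    "\<And>j a b. j < r \<Longrightarrow> -1 \<le> a \<Longrightarrow> a \<le> b \<Longrightarrow> b \<le> 1 \<Longrightarrow> G j b - G j a = integral {a..b} (G (Suc j))"
proof -
  let ?h = "\<lambda>x. if x \<in> \<Omega> then c * u x else 0"
  obtain B where B: "\<And>x. x \<in> \<Omega> \<Longrightarrow> \<bar>u x\<bar> \<le> B" using D_bounded[of 0] r by auto
  have eq: "?h = (\<lambda>x. c * (if x \<in> \<Omega> then D 0 x else 0))" by auto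
  have hL2: "?h \<in> L2"
    unfolding eq using r by (intro L2_on_cmult restricted_L2) auto
  have hB: "\<bar>?h x\<bar> \<le> \<bar>c\<bar> * \<bar>B\<bar>" for x
    using B[of x] by (auto simp: abs_mult intro!: mult_left_mono)
  have hcont: "continuous (at x within {-1..1}) ?h" if "x \<in> {-1..1} - ({-1..1} - \<Omega>)" for x
  proof -
    have x: "x \<in> \<Omega>" using that by auto
    have "continuous_on \<Omega> (\<lambda>x. c * u x)"
      using D_continuous_\<Omega>[of 0] r by (auto intro: continuous_intros)
    then have "continuous_on \<Omega> ?h" by (rule continuous_on_cong[THEN iffD1, rotated 2]) auto
    then have "\<forall>x\<in>\<Omega>. isCont ?h x"
      by (rule continuous_on_eq_continuous_at[THEN iffD1, rotated]) auto
    then have "isCont ?h x" using x by (rule bspec)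
    then show ?thesis by (rule continuous_at_imp_continuous_at_within)
  qed
  show thesis
  proof (rule L2_chain_exists[OF r _ hL2 hB finite_outside hcont, of t v])
    show "t \<in> {-1..1}" using t by simp
  qed (assumption, rule that)
qed

text \<open>No jump is prescribed for the derivatives of order \<open>r, \<dots>, 2r - 1\<close>, so \<open>u\<^sup>(\<^sup>r\<^sup>)\<close> extends across \<open>t\<close>
  to a function in \<open>L\<^sub>2\<^sup>r\<close>; this is the extremal function.\<close>

lemma extremal_chain:
  obtains G where "L2_chain r G" "\<And>x. x \<in> \<Omega> \<Longrightarrow> G r x = - ((-1) ^ r * lam) * u x"
    "\<And>x. x \<in> \<Omega> \<Longrightarrow> G 0 x = D r x"
proof -
  have "\<exists>p. (D (r + j) \<longlongrightarrow> p) (at_right t) \<and> (D (r + j) \<longlongrightarrow> p) (at_left t)" if "j < r" for j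
  proof -
    have j: "r + j < 2 * r" using that by simp
    obtain p q where "(D (r + j) \<longlongrightarrow> p) (at_right t)" "(D (r + j) \<longlongrightarrow> q) (at_left t)"
      "p - q = (if r + j = r - Suc k then - ((-1) ^ k) else 0)"
      using D_jump[OF j] by blast
    \<comment> \<open>The only jump sits at an order below \<open>r\<close>.\<close>
    moreover have "r + j \<noteq> r - Suc k" using k by simp
    ultimately show ?thesis by (intro exI[of _ p]) simp
  qed
  then obtain v where v: "\<And>j. j < r \<Longrightarrow> (D (r + j) \<longlongrightarrow> v j) (at_right t)"
      "\<And>j. j < r \<Longrightarrow> (D (r + j) \<longlongrightarrow> v j) (at_left t)"
    by metis
  obtain G where G: "L2_chain r G" "G r = (\<lambda>x. if x \<in> \<Omega> then - ((-1) ^ r * lam) * u x else 0)"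
      "\<And>j. j < r \<Longrightarrow> G j t = v j"
      "\<And>j a b. j < r \<Longrightarrow> -1 \<le> a \<Longrightarrow> a \<le> b \<Longrightarrow> b \<le> 1 \<Longrightarrow> G j b - G j a = integral {a..b} (G (Suc j))"
    by (rule restricted_u_chain[of "- ((-1) ^ r * lam)" v]) (rule that)
  have contG: "isCont (G j) t" if "j < r" for j
  proof -
    have "continuous_on {-1..1} (nderiv_on {-1..1} j (G 0))"
      using L2_diff_derivatives(2)[OF L2_chain_imp_L2_diff[OF G(1) r] that] .
    then have "continuous_on {-1..1} (G j)"
      by (rule continuous_on_cong[THEN iffD1, rotated 2]) (auto simp: L2_chain_nderiv_on[OF G(1) that])
    then show ?thesis using t by (intro continuous_on_interior[of "{-1..1}"]) auto
  qed
  \<comment> \<open>Downward induction on \<open>j\<close>, starting from the differential equation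
    at \<open>j = r\<close>. At each step the difference of the two sides is constant on each piece
    because their derivatives agree, and it tends to 0 at \<open>t\<close> because both tend to
    \<open>v j\<close>.\<close>
  have "G j x = D (r + j) x" if "j \<le> r" "x \<in> \<Omega>" for j x
    using that
  proof (induction "r - j" arbitrary: j x)
    case 0
    then have "j = r" by simp
    then show ?case using 0 G(2) D_top by (simp add: mult_2)
  next
    case (Suc n)
    have j: "j < r" "r + j < 2 * r" using Suc.hyps(2) by auto
    have IH: "\<And>y. y \<in> \<Omega> \<Longrightarrow> G (Suc j) y = D (Suc (r + j)) y"
      using Suc.hyps(1)[of "Suc j"] Suc.hyps(2) j by simp
    \<comment> \<open>At \<open>j = r - 1\<close> the order is \<open>2 * r - 1\<close>, for which
      the derivative is available only almost everywhere.\<close>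
    obtain E where E: "negligible E"
        "\<And>x. x \<in> \<Omega> - E \<Longrightarrow> (D (r + j) has_vector_derivative D (Suc (r + j)) x) (at x)"
      by (rule D_deriv_ae[OF j(2)]) (rule that)
    have incr: "D (r + j) b - D (r + j) a = G j b - G j a"
      if ab: "a \<le> b" "{a..b} \<subseteq> S" "S \<in> pieces" for a b S
    proof -
      have sub: "{a..b} \<subseteq> \<Omega>" using ab by auto
      have "(D (Suc (r + j)) has_integral (D (r + j) b - D (r + j) a)) {a..b}"
      proof (rule fundamental_theorem_of_calculus_abs_continuous[OF ab(1) _ E(1)])
        show "abs_continuous_on {a..b} (D (r + j))"
          by (rule abs_continuous_on_subset[OF D_abs_continuous[OF j(2) ab(3)] ab(2)])
        show "(D (r + j) has_vector_derivative D (Suc (r + j)) x) (at x within {a..b})"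
          if "x \<in> {a..b} - E" for x
        proof -
          have "x \<in> \<Omega> - E" using that sub by blast
          then show ?thesis by (rule has_vector_derivative_at_within[OF E(2)])
        qed
      qed
      then have "D (r + j) b - D (r + j) a = integral {a..b} (D (Suc (r + j)))"
        by (rule integral_unique[symmetric])
      also have "\<dots> = integral {a..b} (G (Suc j))"
        by (rule integral_cong) (use IH sub in auto)
      also have "\<dots> = G j b - G j a"
      proof -
        have "a \<in> \<Omega>" "b \<in> \<Omega>" using sub ab(1) by auto
        then have "-1 \<le> a" "b \<le> 1" using t by auto
        then show ?thesis using G(4)[OF j(1)] ab(1) by simp
      qed
      finally show ?thesis .
    qed
    consider "x \<in> {-1<..<t}" | "x \<in> {t<..<1}" using Suc.prems by auto
    then show ?case
    proof cases
      case 1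
      have "((\<lambda>y. D (r + j) y - G j y) \<longlongrightarrow> v j - v j) (at_left t)"
        using contG[OF j(1)] G(3)[OF j(1)]
        by (intro tendsto_diff v j) (auto simp: isCont_def intro: tendsto_within_subset)
      moreover have "((\<lambda>y. D (r + j) y - G j y) \<longlongrightarrow> D (r + j) x - G j x) (at_left t)"
      proof (rule tendsto_eventually)
        have "D (r + j) y - G j y = D (r + j) x - G j x" if "x < y" "y < t" for y
        proof -
          have "{x..y} \<subseteq> {-1<..<t}" using 1 that by auto
          then show ?thesis using incr[of x y "{-1<..<t}"] that by simp
        qed
        then show "\<forall>\<^sub>F y in at_left t. D (r + j) y - G j y = D (r + j) x - G j x"
          using 1 by (auto simp: eventually_at_left intro!: exI[of _ x])
      qed
      ultimately have "v j - v j = D (r + j) x - G j x"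
        using tendsto_unique trivial_limit_at_left_real by blast
      then show ?thesis by simp
    next
      case 2
      have "((\<lambda>y. D (r + j) y - G j y) \<longlongrightarrow> v j - v j) (at_right t)"
        using contG[OF j(1)] G(3)[OF j(1)]
        by (intro tendsto_diff v j) (auto simp: isCont_def intro: tendsto_within_subset)
      moreover have "((\<lambda>y. D (r + j) y - G j y) \<longlongrightarrow> D (r + j) x - G j x) (at_right t)"
      proof (rule tendsto_eventually)
        have "D (r + j) y - G j y = D (r + j) x - G j x" if "t < y" "y < x" for y
        proof -
          have "{y..x} \<subseteq> {t<..<1}" using 2 that by auto
          then show ?thesis using incr[of y x "{t<..<1}"] that by simp
        qed
        then show "\<forall>\<^sub>F y in at_right t. D (r + j) y - G j y = D (r + j) x - G j x"
          using 2 by (auto simp: eventually_at_right intro!: exI[of _ x])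
      qed
      ultimately have "v j - v j = D (r + j) x - G j x"
        using tendsto_unique trivial_limit_at_right_real by blast
      then show ?thesis by simp
    qed
  qed
  from this[of 0] G(1,2) show thesis by (intro that[of G]) auto
qed

section \<open>Exact error of \<open>S_opt\<close> and the lower bound for all competitors\<close>

lemma integral_cong_\<Omega>:
  "(\<And>x. x \<in> \<Omega> \<Longrightarrow> f x = g x) \<Longrightarrow>
    (LINT x|lebesgue_on {-1..1}. f x) = (LINT x|lebesgue_on {-1..1}. (g x :: real))"
  by (rule lebesgue_on_integral_finite_difference[OF _ finite_outside]) auto

lemma L2_norm_cong_\<Omega>: "(\<And>x. x \<in> \<Omega> \<Longrightarrow> f x = g x) \<Longrightarrow> L2_norm f = L2_norm g"
  by (rule L2_norm_finite_difference[OF finite_outside]) auto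

lemma U_err_S_opt: "U_err r k t (S_opt r t u) = ereal (L2_norm u)"
proof (rule antisym)
  show "U_err r k t (S_opt r t u) \<le> ereal (L2_norm u)"
    unfolding U_err_def
  proof (rule SUP_least)
    fix f assume "f \<in> W2 r"
    then have f: "f \<in> L2_diff r {-1..1}" "L2_norm (nderiv_on {-1..1} r f) \<le> 1" by (auto simp: W2_def)
    have "\<bar>nderiv_on {-1..1} k f t - S_opt r t u f\<bar> =
        \<bar>LINT x|lebesgue_on {-1..1}. u x * nderiv_on {-1..1} r f x\<bar>"
      by (simp add: representation[OF f(1)] abs_mult)
    also have "\<dots> \<le> L2_norm u * L2_norm (nderiv_on {-1..1} r f)"
      by (rule L2_Cauchy_Schwarz[OF u_L2 L2_diff_derivatives(3)[OF f(1)]]) simp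
    also have "\<dots> \<le> L2_norm u"
      by (rule mult_left_le[OF f(2) L2_norm_nonneg])
    finally show "ereal \<bar>nderiv_on {-1..1} k f t - S_opt r t u f\<bar> \<le> ereal (L2_norm u)" by simp
  qed
  \<comment> \<open>The extremal function has normalised \<open>u\<close> as its derivative of order
    \<open>r\<close>; the initial values 0 at \<open>t\<close> are an arbitrary choice. If the norm
    of \<open>u\<close> is 0, then \<open>c = 0\<close> by the convention for division and the
    equalities below still hold.\<close>
  define c where "c = 1 / L2_norm u"
  obtain F where F: "L2_chain r F" "F r = (\<lambda>x. if x \<in> \<Omega> then c * u x else 0)"
    by (rule restricted_u_chain[of c "\<lambda>_. 0"]) (rule that)
  have "L2_norm (F r) = L2_norm (\<lambda>x. c * u x)"
    by (rule L2_norm_cong_\<Omega>) (simp add: F(2))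
  then have "L2_norm (F r) \<le> 1"
    unfolding L2_norm_cmult by (simp add: c_def L2_norm_nonneg)
  then have W: "F 0 \<in> W2 r"
    using L2_chain_imp_L2_diff[OF F(1) r] L2_chain_norm_top[OF F(1) r] by (simp add: W2_def)
  then have "F 0 \<in> L2_diff r {-1..1}" by (simp add: W2_def)
  from representation[OF this]
  have "\<bar>nderiv_on {-1..1} k (F 0) t - S_opt r t u (F 0)\<bar> =
      \<bar>LINT x|lebesgue_on {-1..1}. u x * F r x\<bar>"
    by (simp add: abs_mult L2_chain_integral_top[OF F(1) r])
  also have "(LINT x|lebesgue_on {-1..1}. u x * F r x) = (LINT x|lebesgue_on {-1..1}. c * (u x * u x))"
    by (rule integral_cong_\<Omega>) (simp add: F(2))
  also have "\<dots> = c * (L2_norm u)\<^sup>2" by (simp add: L2_norm_power2)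
  also have "\<dots> = L2_norm u" by (simp add: c_def power2_eq_square)
  finally have "ereal (L2_norm u) \<le> ereal \<bar>nderiv_on {-1..1} k (F 0) t - S_opt r t u (F 0)\<bar>" by simp
  also have "\<dots> \<le> U_err r k t (S_opt r t u)"
    unfolding U_err_def by (rule SUP_upper[OF W])
  finally show "ereal (L2_norm u) \<le> U_err r k t (S_opt r t u)" .
qed

lemma D_r_L2: "D r \<in> L2"
  using r by (intro D_L2) auto

lemma U_err_lower_bound:
  assumes S: "bounded_functional S" "functional_norm S \<le> L2_norm (D r)"
  shows "ereal (L2_norm u) \<le> U_err r k t S"
proof -
  define N where "N = L2_norm (D r)"
  obtain G where G: "L2_chain r G" "\<And>x. x \<in> \<Omega> \<Longrightarrow> G r x = - ((-1) ^ r * lam) * u x"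
    "\<And>x. x \<in> \<Omega> \<Longrightarrow> G 0 x = D r x"
    by (rule extremal_chain) (rule that)
  have G0: "G 0 \<in> L2_diff r {-1..1}" by (rule L2_chain_imp_L2_diff[OF G(1) r])
  have G0_L2: "G 0 \<in> L2" using L2_diff_derivatives(3)[OF G0, of 0] by simp
  have normG0: "L2_norm (G 0) = N" unfolding N_def by (rule L2_norm_cong_\<Omega>) (rule G(3))
  have normGr: "L2_norm (G r) = lam * L2_norm u"
  proof -
    have "L2_norm (G r) = L2_norm (\<lambda>x. - ((-1) ^ r * lam) * u x)"
      by (rule L2_norm_cong_\<Omega>) (rule G(2))
    then show ?thesis using lam by (simp only: L2_norm_cmult) (simp add: abs_mult)
  qed
  have opt: "S_opt r t u f = (LINT x|lebesgue_on {-1..1}. G 0 x * f x)" for f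
    unfolding S_opt_def by (rule integral_cong_\<Omega>) (simp add: G(3))
  \<comment> \<open>The error identity is applied to the extremal function itself. Since
    \<open>S_opt\<close> is integration against \<open>G 0\<close>, it contributes
    \<open>N\<^sup>2\<close>; the two factors \<open>(-1) ^ r\<close> cancel in the remaining
    term.\<close>
  have Gk: "G k t = N\<^sup>2 + lam * (L2_norm u)\<^sup>2"
  proof -
    have "G k t - S_opt r t u (G 0) = - ((-1) ^ r) * (LINT x|lebesgue_on {-1..1}. u x * G r x)"
      using representation[OF G0] L2_chain_nderiv_on[OF G(1) k, of t] t
      by (simp add: L2_chain_integral_top[OF G(1) r])
    also have "(LINT x|lebesgue_on {-1..1}. u x * G r x) =
        (LINT x|lebesgue_on {-1..1}. - ((-1) ^ r * lam) * (u x * u x))"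
      by (rule integral_cong_\<Omega>) (simp add: G(2))
    also have "\<dots> = - ((-1) ^ r * lam) * (L2_norm u)\<^sup>2"
      unfolding L2_norm_power2 by (rule integral_mult_right_zero)
    also have "- ((-1) ^ r) * (- ((-1) ^ r * lam) * (L2_norm u)\<^sup>2) = lam * (L2_norm u)\<^sup>2"
      by (simp add: minus_one_power_cancel mult.assoc)
    finally show ?thesis by (simp add: opt normG0 flip: L2_norm_power2)
  qed
  have SG: "\<bar>S (G 0)\<bar> \<le> N\<^sup>2"
    using functional_norm_bound[OF S(1) G0_L2] mult_right_mono[OF S(2) L2_norm_nonneg[of "G 0"]]
    by (simp add: normG0 N_def power2_eq_square)
  show ?thesis
  proof (cases "lam = 0")
    case False
    then have lam_pos: "lam > 0" using lam by simp
    \<comment> \<open>This scaling gives the derivative of order \<open>r\<close> norm 1, or makes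
      \<open>c = 0\<close> when the norm of \<open>u\<close> is 0.\<close>
    define c where "c = 1 / (lam * L2_norm u)"
    have c: "c \<ge> 0" using lam L2_norm_nonneg[of u] by (simp add: c_def)
    have W: "(\<lambda>x. c * G 0 x) \<in> W2 r"
      by (rule L2_chain_scaled_W2[OF G(1) r]) (simp add: normGr c_def lam L2_norm_nonneg)
    have "L2_norm u = c * (lam * (L2_norm u)\<^sup>2)"
      using lam_pos by (simp add: c_def power2_eq_square)
    also have "\<dots> \<le> c * (G k t - S (G 0))"
      using SG c by (intro mult_left_mono) (auto simp: Gk)
    also have "\<dots> = nderiv_on {-1..1} k (\<lambda>x. c * G 0 x) t - S (\<lambda>x. c * G 0 x)"
      using L2_chain_scaled_nderiv_on[OF G(1) k, of t c] t S(1) G0_L2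
      by (simp add: bounded_functional_def right_diff_distrib)
    also have "\<dots> \<le> \<bar>nderiv_on {-1..1} k (\<lambda>x. c * G 0 x) t - S (\<lambda>x. c * G 0 x)\<bar>" by simp
    finally have "ereal (L2_norm u) \<le> ereal \<bar>nderiv_on {-1..1} k (\<lambda>x. c * G 0 x) t - S (\<lambda>x. c * G 0 x)\<bar>"
      by simp
    also have "\<dots> \<le> U_err r k t S" unfolding U_err_def by (rule SUP_upper[OF W])
    finally show ?thesis .
  next
    case True
    show ?thesis
    proof (cases "S (G 0) = G k t")
      case False
      have "U_err r k t S = \<infinity>"
      proof (rule U_err_eq_infinity[OF G(1) r k _ _ S(1) False])
        show "L2_norm (G r) = 0" using True normGr by simp
      qed (use t in simp)
      then show ?thesis by simp
    next
      case attained: True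
      \<comment> \<open>For \<open>lam = 0\<close> the required value \<open>G k t\<close> is
        \<open>N\<^sup>2\<close>, so \<open>S\<close> attains the largest value allowed by its norm
        at \<open>G 0\<close> and must be integration against it.\<close>
      have "S f = S_opt r t u f" if "f \<in> W2 r" for f
        unfolding opt
      proof (rule functional_eq_if_norm_attained[OF S(1) _ G0_L2 _ W2_imp_L2[OF that]])
        show "functional_norm S \<le> L2_norm (G 0)" using S(2) normG0 by (simp add: N_def)
        show "S (G 0) = (L2_norm (G 0))\<^sup>2" using Gk True attained normG0 by simp
      qed
      then have "U_err r k t S = U_err r k t (S_opt r t u)"
        unfolding U_err_def by (intro SUP_cong refl) simp
      then show ?thesis by (simp add: U_err_S_opt)
    qed
  qed
qed

lemma E_err_eq: "E_err r k t (L2_norm (D r)) = ereal (L2_norm u)"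
proof (rule antisym)
  have "bounded_functional (S_opt r t u)" "functional_norm (S_opt r t u) \<le> L2_norm (D r)"
    using bounded_functional_integral[OF D_r_L2] unfolding S_opt_def[abs_def] by auto
  then have "E_err r k t (L2_norm (D r)) \<le> U_err r k t (S_opt r t u)"
    unfolding E_err_def by (intro INF_lower) simp
  then show "E_err r k t (L2_norm (D r)) \<le> ereal (L2_norm u)"
    by (simp add: U_err_S_opt)
  show "ereal (L2_norm u) \<le> E_err r k t (L2_norm (D r))"
    unfolding E_err_def by (rule INF_greatest) (use U_err_lower_bound in auto)
qed

end

theorem theorem6:
  fixes r k :: nat and t :: real
  assumes "r \<ge> 1" and "k \<le> r - 1" and "t \<in> {-1<..<1}"
  shows "(\<forall>N. 0 < N \<and> N < sharp_const r k t \<longrightarrow> E_err r k t N = \<infinity>) \<and>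
         (\<forall>N lam u. sharp_const r k t \<le> N \<and> 0 \<le> lam \<and> is_u r k lam t u \<and>
              N = L2_norm (pderivs t r u) \<longrightarrow>
            E_err r k t N = U_err r k t (S_opt r t u) \<and>
            U_err r k t (S_opt r t u) = ereal (L2_norm u))"
proof (intro conjI allI impI; elim conjE)
  show "E_err r k t N = \<infinity>" if "N < sharp_const r k t" for N
    by (rule E_err_below_sharp_const[OF assms that])
next
  fix N lam u assume "0 \<le> lam" "is_u r k lam t u" and N: "N = L2_norm (pderivs t r u)"
  then interpret bvp_solution r k lam t u
    using assms by unfold_locales auto
  show "E_err r k t N = U_err r k t (S_opt r t u)" by (simp add: N E_err_eq U_err_S_opt)
  show "U_err r k t (S_opt r t u) = ereal (L2_norm u)" by (rule U_err_S_opt)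
qed

end
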